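(* Let $n\ge 2$, let $\Omega\subset\mathbb{R}^n$ be a bounded open set, and let $\alpha\in(0,n)$. Let $\nu$ be a positive Borel measure on $\Omega$ such that, for some $d\in(0,n]$, (i) there is a constant $C_d'>0$ with $\nu(B(x,r))\le C_d' r^d$ for all $x\in\mathbb{R}^n$ and all $r>0$; (ii) there exist $x_0\in\Omega$, $\varrho_0>0$ and $C_0>0$ such that $C_0\varrho^d\le \nu(B(x_0,\varrho)\cap\Omega)$ for all $0<\varrho\le\varrho_0$. Let $\gamma<\left(\frac dn\right)\gamma(\alpha)\,\omega_n^{-\frac{n-\alpha}{n}}$. Then there exists a positive constant $C=C(n,\alpha,\Omega,C_d',\gamma)$ such that $$\int_\Omega \exp\left(\gamma|I_\alpha f(x)|\right)\,d\nu\le C$$ for every $f\in L^{\frac n\alpha,\infty}(\Omega)$ with $\|\,|f|\,\|_{L^{\frac n\alpha,\infty}(\Omega)}\le 1$. Moreover, the result is sharp in the sense that for any $\gamma\ge\left(\frac dn\right)\gamma(\alpha)\,\omega_n^{-\frac{n-\alpha}{n}}$ the integral $\int_\Omega \exp(\gamma|I_\alpha f(x)|)\,d\nu$ cannot be uniformly bounded over all $f\in L^{\frac n\alpha,\infty}(\Omega)$ with $\|\,|f|\,\|_{L^{\frac n\alpha,\infty}(\Omega)}\le 1$.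
   Context: $B(x,r)$ is the ball of radius $r$ centered at $x$; $\nu$ is regarded as a measure on $\mathbb{R}^n$ vanishing outside $\Omega$, so $\nu(B(x,r))=\nu(B(x,r)\cap\Omega)$. $|E|$ is the Lebesgue measure of $E$, and $\omega_n$ is the Lebesgue measure of the unit ball of $\mathbb{R}^n$. $C=C(\dots)$ means a constant depending only on the listed quantities (dependence on $C_d'$ being understood together with its exponent $d$). The real number $\gamma$ is not to be confused with the function $\gamma(\alpha)=\frac{\pi^{n/2}2^\alpha\Gamma(\alpha/2)}{\Gamma\left(\frac{n-\alpha}{2}\right)}$. For $\alpha\in(0,n)$, the Riesz potential is $I_\alpha f(x)=\frac1{\gamma(\alpha)}\int_{\mathbb{R}^n}\frac{f(y)}{|x-y|^{n-\alpha}}\,dy$; a function $f$ on $\Omega$ is extended by $0$ to $\mathbb{R}^n$. For a measurable function $g$ on $\Omega$, its non-increasing rearrangement is $g^*(t)=\inf\{\lambda>0:\ |\{x\in\Omega:|g(x)|>\lambda\}|\le t\}$, $t>0$. For $1\le p<\infty$, $L^{p,\infty}(\Omega)$ is the space of measurable $g$ with $\|g\|_{L^{p,\infty}(\Omega)}=\sup_{0<s<|\Omega|}s^{1/p}g^*(s)<\infty$. *)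

theory Defs
  imports "HOL-Analysis.Analysis"
begin

definition riesz_const :: "'n::finite itself \<Rightarrow> real \<Rightarrow> real" where
  "riesz_const _ \<alpha> =
     pi powr (real CARD('n) / 2) * 2 powr \<alpha> * Gamma (\<alpha> / 2) / Gamma ((real CARD('n) - \<alpha>) / 2)"

text \<open>
  The integral of the positive part minus that of the negative part, so that a potential which
  diverges to infinity at a point has that value there (the Bochner integral would give 0).
  Where both parts diverge the integral is undefined; since \<open>\<infinity> - \<infinity> = \<infinity>\<close> on \<^typ>\<open>ereal\<close>,
  the value is then \<open>\<infinity>\<close>.
\<close>
definition riesz_potential :: "real \<Rightarrow> (real^'n \<Rightarrow> real) \<Rightarrow> real^'n \<Rightarrow> ereal" where
  "riesz_potential \<alpha> f x =
     ereal (1 / riesz_const TYPE('n) \<alpha>) *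
       (enn2ereal (\<integral>\<^sup>+ y. ennreal (f y / norm (x - y) powr (real CARD('n) - \<alpha>)) \<partial>lebesgue)
      - enn2ereal (\<integral>\<^sup>+ y. ennreal (- f y / norm (x - y) powr (real CARD('n) - \<alpha>)) \<partial>lebesgue))"

definition zero_extension :: "'a set \<Rightarrow> ('a \<Rightarrow> real) \<Rightarrow> 'a \<Rightarrow> real" where
  "zero_extension \<Omega> f = (\<lambda>x. if x \<in> \<Omega> then f x else 0)"

definition exp_ereal :: "ereal \<Rightarrow> ennreal" where
  "exp_ereal x = (case x of ereal r \<Rightarrow> ennreal (exp r) | PInfty \<Rightarrow> \<infinity> | MInfty \<Rightarrow> 0)"

definition rearrangement :: "(real^'n) set \<Rightarrow> (real^'n \<Rightarrow> real) \<Rightarrow> real \<Rightarrow> ennreal" where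
  "rearrangement \<Omega> g t =
     Inf {ennreal l | l. l > 0 \<and> emeasure lebesgue {x \<in> \<Omega>. \<bar>g x\<bar> > l} \<le> ennreal t}"

definition weak_norm :: "(real^'n) set \<Rightarrow> real \<Rightarrow> (real^'n \<Rightarrow> real) \<Rightarrow> ennreal" where
  "weak_norm \<Omega> p g =
     (SUP s \<in> {s. 0 < s \<and> ennreal s < emeasure lebesgue \<Omega>}.
        ennreal (s powr (1 / p)) * rearrangement \<Omega> g s)"

definition weak_Lp :: "(real^'n) set \<Rightarrow> real \<Rightarrow> (real^'n \<Rightarrow> real) set" where
  "weak_Lp \<Omega> p = {g. g \<in> borel_measurable (lebesgue_on \<Omega>) \<and> weak_norm \<Omega> p g < \<infinity>}"

definition borel_measure_on :: "(real^'n) set \<Rightarrow> (real^'n) measure \<Rightarrow> bool" where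
  "borel_measure_on \<Omega> \<nu> \<longleftrightarrow> sets \<nu> = sets borel \<and> emeasure \<nu> (- \<Omega>) = 0"

definition upper_growth :: "(real^'n) measure \<Rightarrow> real \<Rightarrow> real \<Rightarrow> bool" where
  "upper_growth \<nu> d C \<longleftrightarrow> (\<forall>x. \<forall>r>0. emeasure \<nu> (ball x r) \<le> ennreal (C * r powr d))"

definition lower_growth :: "(real^'n) set \<Rightarrow> (real^'n) measure \<Rightarrow> real \<Rightarrow> bool" where
  "lower_growth \<Omega> \<nu> d \<longleftrightarrow>
     (\<exists>x\<^sub>0\<in>\<Omega>. \<exists>\<rho>\<^sub>0>0. \<exists>C\<^sub>0>0. \<forall>\<rho>. 0 < \<rho> \<and> \<rho> \<le> \<rho>\<^sub>0 \<longrightarrow>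
        ennreal (C\<^sub>0 * \<rho> powr d) \<le> emeasure \<nu> (ball x\<^sub>0 \<rho> \<inter> \<Omega>))"

definition critical_const :: "'n::finite itself \<Rightarrow> real \<Rightarrow> real \<Rightarrow> real" where
  "critical_const T \<alpha> d =
     (d / real CARD('n)) * riesz_const T \<alpha>
       * measure lebesgue (ball (0 :: real^'n) 1) powr (- (real CARD('n) - \<alpha>) / real CARD('n))"

definition exp_integral ::
  "(real^'n) set \<Rightarrow> (real^'n) measure \<Rightarrow> real \<Rightarrow> real \<Rightarrow> (real^'n \<Rightarrow> real) \<Rightarrow> ennreal" where
  "exp_integral \<Omega> \<nu> \<alpha> \<gamma> f =
     (\<integral>\<^sup>+ x\<in>\<Omega>. exp_ereal (ereal \<gamma> * \<bar>riesz_potential \<alpha> (zero_extension \<Omega> f) x\<bar>) \<partial>\<nu>)"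

end

theory Submission
  imports Defs
begin

text \<open>
  Split the Riesz integral of \<open>\<bar>f\<bar>\<close> at \<open>x\<close> at distance \<open>\<delta> \<le> 1\<close>. Since the integral of \<open>\<bar>f\<bar>\<close> over a set \<open>E\<close>
  is at most \<open>n / (n - \<alpha>) * \<bar>E\<bar> powr (1 - \<alpha> / n)\<close>, a layer cake decomposition of the kernel bounds
  the far part by a constant plus \<open>L * ln (1 / \<delta>)\<close>, where \<open>L = n * \<omega> powr (1 - \<alpha> / n)\<close> is sharp.
  By Young's inequality the near part is at most a constant plus \<open>\<delta> powr \<beta> * H x\<close>, where \<open>H x\<close> is the
  integral of \<open>\<bar>f y\<bar> powr q * norm (x - y) powr - b\<close>, with \<open>q < n / \<alpha>\<close>, \<open>b < d\<close> and \<open>\<beta> = b - n + \<alpha> * q\<close>.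
  Taking \<open>\<delta> = max 1 (H x) powr (- 1 / \<beta>)\<close> shows that the exponential of \<open>\<beta> / L\<close> times the Riesz
  integral is at most a constant times \<open>1 + H x\<close>. By Tonelli and the growth of \<open>\<nu>\<close> the integral of
  \<open>H\<close> is bounded, and \<open>\<beta>\<close> can be taken as close to \<open>d\<close> as desired.

  For sharpness, \<open>f y = (\<omega> * norm (x\<^sub>0 - y) powr n) powr (- \<alpha> / n)\<close> has weak norm at most 1, and at distance
  \<open>\<rho>\<close> from \<open>x\<^sub>0\<close> its Riesz integral is at least \<open>L * ln (1 / \<rho>)\<close> up to a constant. So at the critical
  exponent the integrand dominates a multiple of \<open>\<rho> powr - d\<close>, which is not integrable with respect
  to \<open>\<nu>\<close>.
\<close>

section \<open>Layer cake formulas\<close>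

text \<open>\<open>ennreal (g y - c)\<close> truncates at 0, so it is the length of the interval of
  levels from \<open>c\<close> to \<open>g y\<close>; Tonelli then swaps the integrals over
  \<open>y\<close> and \<open>s\<close>. The weight \<open>w\<close> will be a density or the
  indicator of a set.\<close>

lemma (in sigma_finite_measure) layer_cake_weighted:
  fixes g :: "'a \<Rightarrow> real" and w :: "'a \<Rightarrow> ennreal"
  assumes [measurable]: "g \<in> borel_measurable M" "w \<in> borel_measurable M"
  shows "(\<integral>\<^sup>+ y. w y * ennreal (g y - c) \<partial>M)
       = (\<integral>\<^sup>+ s. (\<integral>\<^sup>+ y. w y * indicator {s<..} (g y) \<partial>M) * indicator {c<..} s \<partial>lborel)"
proof -
  interpret pair_sigma_finite M lborel ..
  have "w y * ennreal (g y - c) = (\<integral>\<^sup>+ s. w y * indicator {s<..} (g y) * indicator {c<..} s \<partial>lborel)" for y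
  proof -
    have "(\<integral>\<^sup>+ s. w y * indicator {s<..} (g y) * indicator {c<..} s \<partial>lborel)
        = (\<integral>\<^sup>+ s. w y * indicator {c<..<g y} s \<partial>lborel)"
      by (intro nn_integral_cong) (auto split: split_indicator)
    also have "\<dots> = w y * ennreal (g y - c)"
      by (cases "c \<le> g y") (auto simp: nn_integral_cmult_indicator ennreal_neg)
    finally show ?thesis by simp
  qed
  then have "(\<integral>\<^sup>+ y. w y * ennreal (g y - c) \<partial>M)
      = (\<integral>\<^sup>+ y. (\<integral>\<^sup>+ s. w y * indicator {s<..} (g y) * indicator {c<..} s \<partial>lborel) \<partial>M)"
    by simp
  also have "\<dots> = (\<integral>\<^sup>+ s. (\<integral>\<^sup>+ y. w y * indicator {s<..} (g y) * indicator {c<..} s \<partial>M) \<partial>lborel)"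
  proof (rule Fubini'[symmetric])
    have "Measurable.pred (M \<Otimes>\<^sub>M lborel) (\<lambda>p. g (fst p) > snd p)"
      by measurable
    then show "(\<lambda>(y, s). w y * indicator {s<..} (g y) * indicator {c<..} s) \<in> borel_measurable (M \<Otimes>\<^sub>M lborel)"
      by (simp add: indicator_def case_prod_beta)
  qed
  also have "\<dots> = (\<integral>\<^sup>+ s. (\<integral>\<^sup>+ y. w y * indicator {s<..} (g y) \<partial>M) * indicator {c<..} s \<partial>lborel)"
    by (intro nn_integral_cong nn_integral_multc) measurable
  finally show ?thesis .
qed

lemma nn_integral_powr_tail:
  fixes A c p :: real
  assumes "1 < p" "0 < c" "0 \<le> A"
  shows "(\<integral>\<^sup>+ s. ennreal (A * s powr - p) * indicator {c<..} s \<partial>lborel)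
       \<le> ennreal (A * c powr (1 - p) / (p - 1))"
proof -
  define F where "F s = - (A * s powr (1 - p) / (p - 1))" for s :: real
  have "(\<integral>\<^sup>+ s. ennreal (A * s powr - p) * indicator {c<..} s \<partial>lborel)
      \<le> (\<integral>\<^sup>+ s. ennreal (A * s powr - p) * indicator {c..} s \<partial>lborel)"
    by (intro nn_integral_mono) (auto split: split_indicator)
  also have "\<dots> = ennreal (0 - F c)"
  proof (rule nn_integral_FTC_atLeast)
    show "DERIV F s :> A * s powr - p" if "c \<le> s" for s
    proof -
      have "DERIV F s :> - (A * ((1 - p) * s powr (1 - p - 1)) / (p - 1))"
        unfolding F_def using that assms
        by (intro DERIV_minus DERIV_cdivide DERIV_cmult has_real_derivative_powr) auto
      moreover have "- (A * ((1 - p) * s powr (1 - p - 1)) / (p - 1)) = A * s powr - p"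
        using assms by (simp add: field_simps)
      ultimately show ?thesis by simp
    qed
    have "((\<lambda>s. s powr (1 - p)) \<longlongrightarrow> 0) at_top"
      using assms by (intro tendsto_neg_powr filterlim_ident) auto
    from tendsto_mult_left[OF this, of "- A / (p - 1)"] show "(F \<longlongrightarrow> 0) at_top"
      by (simp add: F_def[abs_def])
  qed (use assms in auto)
  also have "0 - F c = A * c powr (1 - p) / (p - 1)"
    by (simp add: F_def)
  finally show ?thesis .
qed

lemma nn_integral_inverse_Icc:
  fixes A a b :: real
  assumes "0 < a" "a \<le> b" "0 \<le> A"
  shows "(\<integral>\<^sup>+ s. ennreal (A / s) * indicator {a..b} s \<partial>lborel) = ennreal (A * ln (b / a))"
proof -
  have "(\<integral>\<^sup>+ s. ennreal (A / s) * indicator {a..b} s \<partial>lborel) = ennreal (A * ln b - A * ln a)"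
    using assms by (intro nn_integral_FTC_Icc) 
      (auto intro!: derivative_eq_intros simp: has_real_derivative_iff_has_vector_derivative[symmetric])
  also have "A * ln b - A * ln a = A * ln (b / a)"
    using assms by (simp add: ln_div right_diff_distrib)
  finally show ?thesis .
qed

text \<open>Levels up to \<open>c\<close> contribute at most \<open>c\<close> times the measure of
  \<open>E\<close>, and the layers above \<open>c\<close> are summed by the tail bound. The
  threshold stays free: some uses take it to be 1, others tune it for a sharp or scale-invariant
  constant.\<close>

lemma (in sigma_finite_measure) nn_integral_le_tail:
  fixes g :: "'a \<Rightarrow> real"
  assumes [measurable]: "g \<in> borel_measurable M" "E \<in> sets M"
    and p: "1 < p" and c: "0 < c" and A: "0 \<le> A"
    and tail: "\<And>s. c < s \<Longrightarrow> emeasure M {y \<in> E. s < g y} \<le> ennreal (A * s powr - p)"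
  shows "(\<integral>\<^sup>+ y\<in>E. ennreal (g y) \<partial>M) \<le> ennreal c * emeasure M E + ennreal (A * c powr (1 - p) / (p - 1))"
proof -
  have "(\<integral>\<^sup>+ y\<in>E. ennreal (g y) \<partial>M) \<le> (\<integral>\<^sup>+ y. ennreal c * indicator E y + indicator E y * ennreal (g y - c) \<partial>M)"
  proof (intro nn_integral_mono)
    fix y
    have "ennreal (g y) \<le> ennreal c + ennreal (g y - c)"
      using c by (cases "c \<le> g y") (auto simp: ennreal_neg ennreal_leI simp flip: ennreal_plus)
    then show "ennreal (g y) * indicator E y \<le> ennreal c * indicator E y + indicator E y * ennreal (g y - c)"
      by (auto split: split_indicator)
  qed
  also have "\<dots> = ennreal c * emeasure M E + (\<integral>\<^sup>+ y. indicator E y * ennreal (g y - c) \<partial>M)"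
    by (subst nn_integral_add) (auto simp: nn_integral_cmult_indicator)
  also have "(\<integral>\<^sup>+ y. indicator E y * ennreal (g y - c) \<partial>M)
      = (\<integral>\<^sup>+ s. (\<integral>\<^sup>+ y. indicator E y * indicator {s<..} (g y) \<partial>M) * indicator {c<..} s \<partial>lborel)"
    by (intro layer_cake_weighted) measurable
  also have "\<dots> \<le> (\<integral>\<^sup>+ s. ennreal (A * s powr - p) * indicator {c<..} s \<partial>lborel)"
  proof (intro nn_integral_mono)
    fix s
    have "(\<integral>\<^sup>+ y. indicator E y * indicator {s<..} (g y) \<partial>M) = (\<integral>\<^sup>+ y. indicator {y \<in> E. s < g y} y \<partial>M)"
      by (intro nn_integral_cong) (auto split: split_indicator)
    also have "{y \<in> E. s < g y} = E \<inter> {y \<in> space M. s < g y}"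
      using sets.sets_into_space[OF assms(2)] by auto
    also have "(\<integral>\<^sup>+ y. indicator (E \<inter> {y \<in> space M. s < g y}) y \<partial>M) = emeasure M (E \<inter> {y \<in> space M. s < g y})"
      by (intro nn_integral_indicator) measurable
    also have "E \<inter> {y \<in> space M. s < g y} = {y \<in> E. s < g y}"
      using sets.sets_into_space[OF assms(2)] by auto
    finally show "(\<integral>\<^sup>+ y. indicator E y * indicator {s<..} (g y) \<partial>M) * indicator {c<..} s
        \<le> ennreal (A * s powr - p) * indicator {c<..} s"
      using tail[of s] by (auto split: split_indicator)
  qed
  also have "\<dots> \<le> ennreal (A * c powr (1 - p) / (p - 1))"
    by (intro nn_integral_powr_tail p c A)
  finally show ?thesis by (simp add: add_left_mono)
qed

text \<open>The set where the kernel exceeds \<open>s\<close> lies in a ball of radius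
  \<open>s powr (- 1 / b)\<close>, so growth of order \<open>d\<close> becomes a tail of exponent
  \<open>d / b > 1\<close>. This serves to integrate the kernel against
  \<open>\<nu>\<close>.\<close>

lemma nn_integral_distance_powr_le:
  fixes M :: "'a::euclidean_space measure"
  assumes "sigma_finite_measure M" and id: "(\<lambda>y. y) \<in> borel_measurable M"
    and growth: "\<And>r. 0 < r \<Longrightarrow> emeasure M {y \<in> space M. norm (x - y) < r} \<le> ennreal (C * r powr d)"
    and b: "0 < b" "b < d" and C: "0 \<le> C"
  shows "(\<integral>\<^sup>+ y. ennreal (norm (x - y) powr - b) \<partial>M) \<le> emeasure M (space M) + ennreal (C / (d / b - 1))"
proof -
  interpret sigma_finite_measure M by fact
  have [measurable]: "(\<lambda>y. norm (x - y)) \<in> borel_measurable M"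
    using measurable_compose[OF id, of "\<lambda>y. norm (x - y)" borel] by simp
  have "(\<integral>\<^sup>+ y\<in>space M. ennreal (norm (x - y) powr - b) \<partial>M)
      \<le> ennreal 1 * emeasure M (space M) + ennreal (C * 1 powr (1 - d / b) / (d / b - 1))"
  proof (rule nn_integral_le_tail)
    fix s :: real assume s: "1 < s"
    have "norm (x - y) < s powr (- 1 / b)" if "s < norm (x - y) powr - b" for y
    proof (rule ccontr)
      assume "\<not> norm (x - y) < s powr (- 1 / b)"
      then have "norm (x - y) powr - b \<le> (s powr (- 1 / b)) powr - b"
        using b s by (intro powr_mono2') auto
      then show False using that s b by (simp add: powr_powr)
    qed
    then have "emeasure M {y \<in> space M. s < norm (x - y) powr - b}
        \<le> emeasure M {y \<in> space M. norm (x - y) < s powr (- 1 / b)}"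
      by (intro emeasure_mono) auto
    also have "\<dots> \<le> ennreal (C * (s powr (- 1 / b)) powr d)"
      using s by (intro growth) simp
    also have "(s powr (- 1 / b)) powr d = s powr - (d / b)"
      by (simp add: powr_powr)
    finally show "emeasure M {y \<in> space M. s < norm (x - y) powr - b} \<le> ennreal (C * s powr - (d / b))" .
  qed (use b C in auto)
  moreover have "(\<integral>\<^sup>+ y\<in>space M. ennreal (norm (x - y) powr - b) \<partial>M) = (\<integral>\<^sup>+ y. ennreal (norm (x - y) powr - b) \<partial>M)"
    by (intro nn_integral_cong) simp
  ultimately show ?thesis by simp
qed

lemma exp_ereal_mono: "x \<le> y \<Longrightarrow> exp_ereal x \<le> exp_ereal y"
  by (cases x; cases y) (auto simp: exp_ereal_def)

lemma divide_le_self: "0 \<le> a \<Longrightarrow> 1 \<le> c \<Longrightarrow> a / c \<le> (a::real)"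
  using mult_left_mono[of 1 c a] by (simp add: divide_le_eq)

section \<open>Riesz integrals of densities of critical weak type\<close>

text \<open>In the application \<open>M\<close> is Lebesgue measure on \<open>\<Omega>\<close>,
  \<open>F\<close> is \<open>\<bar>f\<bar>\<close>, \<open>n\<close> the dimension and
  \<open>\<omega>\<close> the volume of the unit ball. The tail condition is the weak norm bound in
  terms of the distribution function.\<close>

locale weak_type_density = finite_measure M
  for M :: "'a::euclidean_space measure" and F :: "'a \<Rightarrow> real" and n \<alpha> \<omega> :: real +
  assumes measurable_id [measurable]: "(\<lambda>y. y) \<in> borel_measurable M"
    and measurable_density [measurable]: "F \<in> borel_measurable M"
    and density_nonneg: "0 \<le> F y"
    and density_tail: "0 < s \<Longrightarrow> emeasure M {y \<in> space M. s < F y} \<le> ennreal (s powr - (n / \<alpha>))"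
    and ball_growth: "0 < r \<Longrightarrow> emeasure M {y \<in> space M. norm (x - y) < r} \<le> ennreal (\<omega> * r powr n)"
    and exponents: "0 < \<alpha>" "\<alpha> < n" and growth_const_pos: "0 < \<omega>"
begin

text \<open>With \<open>\<omega>\<close> the volume of the unit ball, the critical exponent is
  \<open>d / log_coeff\<close> times \<open>riesz_const\<close>. So the estimates producing this
  coefficient must be sharp, while additive constants are free.\<close>

definition log_coeff :: real where
  "log_coeff = n * \<omega> powr (1 - \<alpha> / n)"

lemma log_coeff_pos: "0 < log_coeff"
  using exponents growth_const_pos by (simp add: log_coeff_def)

section \<open>Sharp estimates away from the singularity\<close>

lemma measurable_distance [measurable]: "(\<lambda>y. norm (x - y)) \<in> borel_measurable M"
  using measurable_compose[OF measurable_id, of "\<lambda>y. norm (x - y)" borel] by simp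

lemma ball_in_sets [measurable, simp]: "{y \<in> space M. norm (x - y) < r} \<in> sets M"
  by (rule borel_measurable_less[OF measurable_distance borel_measurable_const])

text \<open>The bound is the integral of \<open>t powr (- \<alpha> / n)\<close> over
  \<open>{0<..<v}\<close>, the value for a function with the extremal tail; cutting at the right
  level loses nothing.\<close>

lemma nn_integral_density_le:
  assumes [measurable]: "E \<in> sets M" and v: "0 < v" and E: "emeasure M E \<le> ennreal v"
  shows "(\<integral>\<^sup>+ y\<in>E. ennreal (F y) \<partial>M) \<le> ennreal (n / (n - \<alpha>) * v powr (1 - \<alpha> / n))"
proof -
  \<comment> \<open>The level at which the tail bound \<open>c powr - (n / \<alpha>)\<close> equals
    \<open>v\<close>.\<close>
  define c where "c = v powr (- \<alpha> / n)"
  have c: "0 < c" using v by (simp add: c_def)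
  have "(\<integral>\<^sup>+ y\<in>E. ennreal (F y) \<partial>M) \<le> ennreal c * emeasure M E + ennreal (1 * c powr (1 - n / \<alpha>) / (n / \<alpha> - 1))"
  proof (rule nn_integral_le_tail)
    fix s assume "c < s"
    have "emeasure M {y \<in> E. s < F y} \<le> emeasure M {y \<in> space M. s < F y}"
      using sets.sets_into_space[OF assms(1)] by (intro emeasure_mono) auto
    also have "\<dots> \<le> ennreal (1 * s powr - (n / \<alpha>))"
      using density_tail[of s] c \<open>c < s\<close> by simp
    finally show "emeasure M {y \<in> E. s < F y} \<le> ennreal (1 * s powr - (n / \<alpha>))" .
  qed (use c exponents in auto)
  also have "ennreal c * emeasure M E \<le> ennreal (c * v)"
    using E c v by (simp add: ennreal_mult mult_left_mono)
  also have "ennreal (c * v) + ennreal (1 * c powr (1 - n / \<alpha>) / (n / \<alpha> - 1))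
      = ennreal (c * v + c powr (1 - n / \<alpha>) / (n / \<alpha> - 1))"
    using c v exponents by (simp flip: ennreal_plus)
  also have "c * v = v powr (1 - \<alpha> / n)"
    using v by (simp add: c_def powr_diff powr_minus field_simps)
  also have "c powr (1 - n / \<alpha>) = v powr (1 - \<alpha> / n)"
  proof -
    have "- \<alpha> / n * (1 - n / \<alpha>) = 1 - \<alpha> / n" using exponents by (simp add: field_simps)
    then show ?thesis by (simp only: c_def powr_powr)
  qed
  also have "v powr (1 - \<alpha> / n) + v powr (1 - \<alpha> / n) / (n / \<alpha> - 1) = n / (n - \<alpha>) * v powr (1 - \<alpha> / n)"
    using exponents by (simp add: field_simps)
  finally show ?thesis by (simp add: add_right_mono)
qed

lemma nn_integral_density_ball_le:
  assumes r: "0 < r"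
  shows "(\<integral>\<^sup>+ y\<in>{y \<in> space M. norm (x - y) < r}. ennreal (F y) \<partial>M)
    \<le> ennreal (log_coeff / (n - \<alpha>) * r powr (n - \<alpha>))"
proof -
  have "(\<integral>\<^sup>+ y\<in>{y \<in> space M. norm (x - y) < r}. ennreal (F y) \<partial>M)
     \<le> ennreal (n / (n - \<alpha>) * (\<omega> * r powr n) powr (1 - \<alpha> / n))"
    using r growth_const_pos ball_growth[OF r] by (intro nn_integral_density_le) auto
  also have "(\<omega> * r powr n) powr (1 - \<alpha> / n) = \<omega> powr (1 - \<alpha> / n) * r powr (n - \<alpha>)"
  proof -
    have "n * (1 - \<alpha> / n) = n - \<alpha>" using exponents by (simp add: field_simps)
    then show ?thesis using growth_const_pos r by (simp add: powr_mult powr_powr)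
  qed
  also have "n / (n - \<alpha>) * (\<omega> powr (1 - \<alpha> / n) * r powr (n - \<alpha>)) = log_coeff / (n - \<alpha>) * r powr (n - \<alpha>)"
    by (simp add: log_coeff_def)
  finally show ?thesis .
qed

text \<open>Layer cake in the kernel with the density as weight: superlevel sets of the kernel are
  balls, and over the ball of radius \<open>r\<close> the density integrates to at most
  \<open>log_coeff / (n - \<alpha>) / s\<close> with \<open>s = r powr (\<alpha> - n)\<close>.
  Integrating \<open>1 / s\<close> up to the largest kernel value gives the logarithm.\<close>

lemma far_part_le:
  assumes \<delta>: "0 < \<delta>" "\<delta> \<le> D" and D: "\<And>y. y \<in> space M \<Longrightarrow> norm (x - y) < D"
  shows "(\<integral>\<^sup>+ y\<in>{y. \<delta> \<le> norm (x - y)}. ennreal (F y * norm (x - y) powr (\<alpha> - n)) \<partial>M)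
    \<le> ennreal (log_coeff / (n - \<alpha>) + log_coeff * ln (D / \<delta>))"
proof -
  define w where "w y = ennreal (F y) * indicator {y. \<delta> \<le> norm (x - y)} y" for y
  define g where "g y = norm (x - y) powr (\<alpha> - n)" for y
  \<comment> \<open>The kernel at distance \<open>D\<close>. Layers below this height cost at most
    \<open>c\<close> times the integral of the density, where \<open>c\<close> cancels
    \<open>D powr (n - \<alpha>)\<close>.\<close>
  define c where "c = D powr (\<alpha> - n)"
  have D0: "0 < D" using \<delta> by simp
  have c0: "0 < c" using D0 by (simp add: c_def)
  have L0: "0 < log_coeff" by (rule log_coeff_pos)
  have [measurable]: "w \<in> borel_measurable M" "g \<in> borel_measurable M"
    by (simp_all add: w_def[abs_def] g_def[abs_def] indicator_def) measurable
  have "(\<integral>\<^sup>+ y\<in>{y. \<delta> \<le> norm (x - y)}. ennreal (F y * norm (x - y) powr (\<alpha> - n)) \<partial>M)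
      \<le> (\<integral>\<^sup>+ y. ennreal c * w y + w y * ennreal (g y - c) \<partial>M)"
  proof (intro nn_integral_mono)
    fix y
    have "ennreal (g y) \<le> ennreal c + ennreal (g y - c)"
      using c0 by (cases "c \<le> g y") (auto simp: ennreal_neg ennreal_leI simp flip: ennreal_plus)
    then have "w y * ennreal (g y) \<le> w y * (ennreal c + ennreal (g y - c))"
      by (rule mult_left_mono) simp
    then show "ennreal (F y * norm (x - y) powr (\<alpha> - n)) * indicator {y. \<delta> \<le> norm (x - y)} y
        \<le> ennreal c * w y + w y * ennreal (g y - c)"
      using density_nonneg[of y]
      by (simp add: w_def g_def ennreal_mult distrib_left mult_ac)
  qed
  also have "\<dots> = ennreal c * (\<integral>\<^sup>+ y. w y \<partial>M) + (\<integral>\<^sup>+ y. w y * ennreal (g y - c) \<partial>M)"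
    by (simp add: nn_integral_add nn_integral_cmult)
  also have "ennreal c * (\<integral>\<^sup>+ y. w y \<partial>M) \<le> ennreal (log_coeff / (n - \<alpha>))"
  proof -
    have "(\<integral>\<^sup>+ y. w y \<partial>M) \<le> (\<integral>\<^sup>+ y\<in>{y \<in> space M. norm (x - y) < D}. ennreal (F y) \<partial>M)"
      by (intro nn_integral_mono) (auto simp: w_def D split: split_indicator)
    also have "\<dots> \<le> ennreal (log_coeff / (n - \<alpha>) * D powr (n - \<alpha>))"
      by (rule nn_integral_density_ball_le[OF D0])
    finally have "ennreal c * (\<integral>\<^sup>+ y. w y \<partial>M) \<le> ennreal c * ennreal (log_coeff / (n - \<alpha>) * D powr (n - \<alpha>))"
      by (rule mult_left_mono) simp
    also have "\<dots> = ennreal (c * (log_coeff / (n - \<alpha>) * D powr (n - \<alpha>)))"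
      using c0 L0 exponents by (intro ennreal_mult[symmetric]) auto
    also have "c * (log_coeff / (n - \<alpha>) * D powr (n - \<alpha>)) = log_coeff / (n - \<alpha>)"
      using D0 by (simp add: c_def powr_diff)
    finally show ?thesis .
  qed
  also have "(\<integral>\<^sup>+ y. w y * ennreal (g y - c) \<partial>M) \<le> ennreal (log_coeff * ln (D / \<delta>))"
  proof -
    let ?b = "\<delta> powr (\<alpha> - n)"
    have cb: "c \<le> ?b"
      unfolding c_def using \<delta> exponents by (intro powr_mono2') auto
    have "(\<integral>\<^sup>+ y. w y * ennreal (g y - c) \<partial>M)
        = (\<integral>\<^sup>+ s. (\<integral>\<^sup>+ y. w y * indicator {s<..} (g y) \<partial>M) * indicator {c<..} s \<partial>lborel)"
      by (rule layer_cake_weighted) measurable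
    also have "\<dots> \<le> (\<integral>\<^sup>+ s. ennreal (log_coeff / (n - \<alpha>) / s) * indicator {c..?b} s \<partial>lborel)"
    proof (intro nn_integral_mono)
      fix s
      \<comment> \<open>Only the last range contributes: below \<open>c\<close> the layer is cut
        off, and above \<open>?b\<close> it is empty because the kernel is at most \<open>?b\<close>
        off the ball of radius \<open>\<delta>\<close>.\<close>
      consider "s \<le> c" | "?b < s" | "c < s" "s \<le> ?b" by linarith
      then show "(\<integral>\<^sup>+ y. w y * indicator {s<..} (g y) \<partial>M) * indicator {c<..} s
          \<le> ennreal (log_coeff / (n - \<alpha>) / s) * indicator {c..?b} s"
      proof cases
        case 2
        have "w y * indicator {s<..} (g y) = 0" for y
        proof (cases "\<delta> \<le> norm (x - y)")
          case True
          then have "g y \<le> ?b"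
            unfolding g_def using \<delta> exponents by (intro powr_mono2') auto
          then show ?thesis using 2 by simp
        qed (simp add: w_def)
        then show ?thesis by (simp only: nn_integral_const) simp
      next
        case 3
        define r where "r = s powr (1 / (\<alpha> - n))"
        have s0: "0 < s" using 3 c0 by simp
        have r0: "0 < r" using s0 by (simp add: r_def)
        have rs: "r powr (\<alpha> - n) = s" using s0 exponents by (simp add: r_def powr_powr)
        have "norm (x - y) < r" if "s < g y" for y
        proof (rule ccontr)
          assume "\<not> norm (x - y) < r"
          then have "g y \<le> r powr (\<alpha> - n)"
            unfolding g_def using r0 exponents by (intro powr_mono2') auto
          then show False using that rs by simp
        qed
        then have "(\<integral>\<^sup>+ y. w y * indicator {s<..} (g y) \<partial>M)
            \<le> (\<integral>\<^sup>+ y\<in>{y \<in> space M. norm (x - y) < r}. ennreal (F y) \<partial>M)"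
          by (intro nn_integral_mono) (auto simp: w_def split: split_indicator)
        also have "\<dots> \<le> ennreal (log_coeff / (n - \<alpha>) * r powr (n - \<alpha>))"
          by (rule nn_integral_density_ball_le[OF r0])
        also have "r powr (n - \<alpha>) = 1 / s"
          using rs r0 s0 by (simp add: powr_diff divide_simps)
        finally show ?thesis using 3 by simp
      qed simp
    qed
    also have "\<dots> = ennreal (log_coeff / (n - \<alpha>) * ln (?b / c))"
      using cb c0 L0 exponents by (intro nn_integral_inverse_Icc) auto
    also have "log_coeff / (n - \<alpha>) * ln (?b / c) = log_coeff * ln (D / \<delta>)"
      using \<delta> D0 exponents by (simp add: c_def ln_div ln_powr field_simps)
    finally show ?thesis .
  qed
  also have "ennreal (log_coeff / (n - \<alpha>)) + ennreal (log_coeff * ln (D / \<delta>))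
      = ennreal (log_coeff / (n - \<alpha>) + log_coeff * ln (D / \<delta>))"
    using L0 exponents \<delta> by simp
  finally show ?thesis by (simp add: add_mono)
qed

section \<open>Estimates near the singularity\<close>

lemma nn_integral_density_powr_le:
  assumes q: "0 < q" "\<alpha> * q < n"
  shows "(\<integral>\<^sup>+ y. ennreal (F y powr q) \<partial>M) \<le> emeasure M (space M) + ennreal (1 / (n / (\<alpha> * q) - 1))"
proof -
  have "(\<integral>\<^sup>+ y\<in>space M. ennreal (F y powr q) \<partial>M)
      \<le> ennreal 1 * emeasure M (space M) + ennreal (1 * 1 powr (1 - n / (\<alpha> * q)) / (n / (\<alpha> * q) - 1))"
  proof (rule nn_integral_le_tail)
    fix s :: real assume s: "1 < s"
    \<comment> \<open>Superlevel sets of \<open>F y powr q\<close> are superlevel sets of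
      \<open>F\<close>, which turns the tail exponent \<open>n / \<alpha>\<close> into
      \<open>n / (\<alpha> * q) > 1\<close>.\<close>
    have "s powr (1 / q) < F y" if "s < F y powr q" for y
    proof (rule ccontr)
      assume "\<not> s powr (1 / q) < F y"
      then have "F y powr q \<le> (s powr (1 / q)) powr q"
        using density_nonneg[of y] q by (intro powr_mono2) auto
      then show False using that s q by (simp add: powr_powr)
    qed
    then have "emeasure M {y \<in> space M. s < F y powr q} \<le> emeasure M {y \<in> space M. s powr (1 / q) < F y}"
      by (intro emeasure_mono) auto
    also have "\<dots> \<le> ennreal ((s powr (1 / q)) powr - (n / \<alpha>))"
      using s by (intro density_tail) simp
    also have "(s powr (1 / q)) powr - (n / \<alpha>) = 1 * s powr - (n / (\<alpha> * q))"
      using s by (simp add: powr_powr mult.commute)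
    finally show "emeasure M {y \<in> space M. s < F y powr q} \<le> ennreal (1 * s powr - (n / (\<alpha> * q)))" .
  qed (use exponents q in \<open>auto simp: field_simps\<close>)
  moreover have "(\<integral>\<^sup>+ y\<in>space M. ennreal (F y powr q) \<partial>M) = (\<integral>\<^sup>+ y. ennreal (F y powr q) \<partial>M)"
    by (intro nn_integral_cong) simp
  ultimately show ?thesis by simp
qed

text \<open>
  Young's inequality is applied with weights scaled by \<open>\<delta>\<close> so that the conjugate term, the
  integral of \<open>\<delta> powr - n * (norm (x - y) / \<delta>) powr - e\<close> over the ball, does not depend on \<open>\<delta>\<close>.
\<close>

lemma near_part_le:
  fixes q b e :: real
  assumes q: "1 < q" and e: "0 < e" "e < n" "(n - \<alpha> - b / q) * (q / (q - 1)) \<le> e" and \<delta>: "0 < \<delta>"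
  shows "(\<integral>\<^sup>+ y\<in>{y \<in> space M. norm (x - y) < \<delta>}. ennreal (F y * norm (x - y) powr (\<alpha> - n)) \<partial>M)
    \<le> ennreal (\<delta> powr (b - n + \<alpha> * q)) * (\<integral>\<^sup>+ y. ennreal (F y powr q * norm (x - y) powr - b) \<partial>M)
      + ennreal (\<omega> + \<omega> / (n / e - 1))"
proof -
  define E where "E = {y \<in> space M. norm (x - y) < \<delta>}"
  have [measurable]: "E \<in> sets M" by (simp add: E_def)
  define h where "h y = \<delta> powr - n * (norm (x - y) / \<delta>) powr - e" for y
  define \<beta> where "\<beta> = b - n + \<alpha> * q"
  have n0: "0 < n" using exponents by simp
  have [measurable]: "h \<in> borel_measurable M" by (simp add: h_def[abs_def])
  have pointwise: "F y * norm (x - y) powr (\<alpha> - n)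
      \<le> \<delta> powr \<beta> * (F y powr q * norm (x - y) powr - b) + h y" if y: "norm (x - y) < \<delta>" for y
  \<comment> \<open>At \<open>y = x\<close> the left side vanishes, since
    \<open>0 powr a = 0\<close>.\<close>
  proof (cases "x = y")
    case False
    define \<rho> where "\<rho> = norm (x - y) / \<delta>"
    have \<rho>: "0 < \<rho>" "\<rho> < 1" and t: "norm (x - y) = \<rho> * \<delta>"
      using False y \<delta> by (auto simp: \<rho>_def)
    \<comment> \<open>The product is split so that \<open>A powr q\<close> is the weighted integrand
      times \<open>\<delta> powr \<beta>\<close>, while the conjugate power of \<open>B\<close>
      carries no power of \<open>\<delta>\<close> beyond the normalising
      \<open>\<delta> powr - n\<close>.\<close>
    define A where "A = F y * (\<rho> powr (- b / q) * \<delta> powr (\<alpha> - n / q))"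
    define B where "B = \<rho> powr (\<alpha> - n + b / q) * \<delta> powr (n / q - n)"
    let ?p = "q / (q - 1)"
    have "A * B = F y * (\<rho> powr (- b / q + (\<alpha> - n + b / q)) * \<delta> powr (\<alpha> - n / q + (n / q - n)))"
      unfolding A_def B_def powr_add by (simp add: mult_ac)
    also have "\<dots> = F y * norm (x - y) powr (\<alpha> - n)"
      using \<rho> \<delta> by (simp add: t powr_mult)
    finally have AB: "F y * norm (x - y) powr (\<alpha> - n) = A * B" by simp
    have "A * B \<le> A powr q / q + B powr ?p / ?p"
      using q density_nonneg[of y] by (intro Youngs_inequality) (auto simp: A_def B_def field_simps)
    also have "\<dots> \<le> A powr q + B powr ?p"
      using q by (intro add_mono divide_le_self) (auto simp: field_simps)
    also have "A powr q = F y powr q * (\<rho> powr - b * \<delta> powr (\<alpha> * q - n))"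
    proof -
      have "- b / q * q = - b" "(\<alpha> - n / q) * q = \<alpha> * q - n" using q by (auto simp: field_simps)
      then show ?thesis using density_nonneg[of y] by (simp add: A_def powr_mult powr_powr)
    qed
    also have "\<dots> = \<delta> powr \<beta> * (F y powr q * norm (x - y) powr - b)"
    proof -
      have "\<delta> powr (\<alpha> * q - n) = \<delta> powr \<beta> * \<delta> powr - b"
        by (simp add: \<beta>_def flip: powr_add)
      then show ?thesis using \<rho> \<delta> by (simp add: t powr_mult)
    qed
    also have "B powr ?p \<le> h y"
    proof -
      have "(n / q - n) * ?p = - n" using q by (simp add: field_simps)
      then have "B powr ?p = \<rho> powr ((\<alpha> - n + b / q) * ?p) * \<delta> powr - n"
        by (simp add: B_def powr_mult powr_powr)
      also have "\<rho> powr ((\<alpha> - n + b / q) * ?p) \<le> \<rho> powr - e"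
      proof (rule powr_mono')
        have "(\<alpha> - n + b / q) * ?p = - ((n - \<alpha> - b / q) * ?p)" by (simp add: algebra_simps)
        then show "- e \<le> (\<alpha> - n + b / q) * ?p" using e by linarith
      qed (use \<rho> in auto)
      finally show ?thesis by (simp add: h_def \<rho>_def mult.commute mult_right_mono)
    qed
    finally show ?thesis by (simp add: AB)
  qed (auto simp: h_def)
  have "(\<integral>\<^sup>+ y\<in>E. ennreal (F y * norm (x - y) powr (\<alpha> - n)) \<partial>M)
      \<le> (\<integral>\<^sup>+ y. ennreal (\<delta> powr \<beta>) * ennreal (F y powr q * norm (x - y) powr - b) + ennreal (h y) * indicator E y \<partial>M)"
  proof (intro nn_integral_mono)
    fix y
    show "ennreal (F y * norm (x - y) powr (\<alpha> - n)) * indicator E y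
      \<le> ennreal (\<delta> powr \<beta>) * ennreal (F y powr q * norm (x - y) powr - b) + ennreal (h y) * indicator E y"
    proof (cases "y \<in> E")
      case True
      have "0 \<le> h y" by (simp add: h_def)
      then show ?thesis
        using True pointwise[of y] by (simp add: E_def ennreal_leI flip: ennreal_mult ennreal_plus)
    qed simp
  qed
  also have "\<dots> = ennreal (\<delta> powr \<beta>) * (\<integral>\<^sup>+ y. ennreal (F y powr q * norm (x - y) powr - b) \<partial>M)
      + (\<integral>\<^sup>+ y\<in>E. ennreal (h y) \<partial>M)"
    by (subst nn_integral_add) (auto simp: nn_integral_cmult)
  also have "(\<integral>\<^sup>+ y\<in>E. ennreal (h y) \<partial>M) \<le> ennreal (\<omega> + \<omega> / (n / e - 1))"
  proof -
    \<comment> \<open>\<open>?c\<close> is the value of \<open>h\<close> at distance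
      \<open>\<delta>\<close>, and \<open>?A\<close> comes from the volume of the ball containing
      \<open>{y. s < h y}\<close>. All powers of \<open>\<delta>\<close> cancel in the end.\<close>
    let ?c = "\<delta> powr - n" and ?A = "\<omega> * \<delta> powr (n - n * (n / e))"
    have ne: "1 < n / e" using e by simp
    have "(\<integral>\<^sup>+ y\<in>E. ennreal (h y) \<partial>M)
        \<le> ennreal ?c * emeasure M E + ennreal (?A * ?c powr (1 - n / e) / (n / e - 1))"
    proof (rule nn_integral_le_tail)
      fix s assume s: "?c < s"
      moreover have "0 < ?c" using \<delta> by simp
      ultimately have s0: "0 < s" by linarith
      define r where "r = \<delta> * (s * \<delta> powr n) powr (- 1 / e)"
      have r0: "0 < r" using s0 \<delta> by (simp add: r_def)
      have rd: "(r / \<delta>) powr - e = s * \<delta> powr n" using \<delta> s0 e by (simp add: r_def powr_powr)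
      have "norm (x - y) < r" if "s < h y" for y
      proof (rule ccontr)
        assume "\<not> norm (x - y) < r"
        then have "h y \<le> ?c * (r / \<delta>) powr - e"
          unfolding h_def using r0 \<delta> e by (intro mult_left_mono powr_mono2' divide_right_mono) auto
        also have "\<dots> = s"
          unfolding rd using \<delta> by (simp add: powr_minus)
        finally show False using that by simp
      qed
      then have "emeasure M {y \<in> E. s < h y} \<le> emeasure M {y \<in> space M. norm (x - y) < r}"
        by (intro emeasure_mono) (auto simp: E_def)
      also have "\<dots> \<le> ennreal (\<omega> * r powr n)" by (rule ball_growth[OF r0])
      also have "\<omega> * r powr n = ?A * s powr - (n / e)"
      proof -
        have "r powr n = \<delta> powr n * ((s * \<delta> powr n) powr (- 1 / e)) powr n"
          using \<delta> s0 by (simp add: r_def powr_mult)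
        also have "\<dots> = \<delta> powr n * (s powr - (n / e) * \<delta> powr - (n * (n / e)))"
          using \<delta> s0 by (simp add: powr_mult powr_powr)
        finally show ?thesis using \<delta> by (simp add: powr_diff powr_minus field_simps)
      qed
      finally show "emeasure M {y \<in> E. s < h y} \<le> ennreal (?A * s powr - (n / e))" .
    qed (use ne \<delta> growth_const_pos in auto)
    also have "ennreal ?c * emeasure M E \<le> ennreal ?c * ennreal (\<omega> * \<delta> powr n)"
      unfolding E_def using ball_growth[OF \<delta>] by (intro mult_left_mono) auto
    also have "\<dots> = ennreal (?c * (\<omega> * \<delta> powr n))"
      using growth_const_pos by (intro ennreal_mult[symmetric]) auto
    also have "?c * (\<omega> * \<delta> powr n) = \<omega>" using \<delta> by (simp add: powr_minus)
    also have "?A * ?c powr (1 - n / e) = \<omega>"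
    proof -
      have "?A * ?c powr (1 - n / e) = \<omega> * \<delta> powr ((n - n * (n / e)) + (- n) * (1 - n / e))"
        unfolding powr_powr powr_add by (simp add: mult_ac)
      also have "(n - n * (n / e)) + (- n) * (1 - n / e) = 0" by (simp add: algebra_simps)
      finally show ?thesis using \<delta> by simp
    qed
    also have "ennreal \<omega> + ennreal (\<omega> / (n / e - 1)) = ennreal (\<omega> + \<omega> / (n / e - 1))"
      using ne growth_const_pos by (simp flip: ennreal_plus)
    finally show ?thesis by (simp add: add_right_mono)
  qed
  finally show ?thesis by (simp add: E_def \<beta>_def add_left_mono)
qed

section \<open>The exponential of the Riesz integral\<close>

definition riesz_int :: "'a \<Rightarrow> ennreal" where
  "riesz_int x = (\<integral>\<^sup>+ y. ennreal (F y * norm (x - y) powr (\<alpha> - n)) \<partial>M)"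

definition weighted_int :: "real \<Rightarrow> real \<Rightarrow> 'a \<Rightarrow> ennreal" where
  "weighted_int q b x = (\<integral>\<^sup>+ y. ennreal (F y powr q * norm (x - y) powr - b) \<partial>M)"

text \<open>Collects what depends on neither the radius nor the weighted integral in the two
  estimates; the final 1 bounds \<open>\<delta> powr \<beta> * h\<close> at the chosen
  radius.\<close>

definition near_const :: "real \<Rightarrow> real \<Rightarrow> real" where
  "near_const e D = \<omega> + \<omega> / (n / e - 1) + log_coeff / (n - \<alpha>) + log_coeff * ln D + 1"

text \<open>Shrinking the radius until the near term is at most 1 costs
  \<open>log_coeff * ln (1 / \<delta>)\<close> in the far term, which is
  \<open>log_coeff / \<beta> * ln (max 1 h)\<close>.\<close>

lemma riesz_int_le:
  fixes q b e D :: real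
  assumes q: "1 < q" and e: "0 < e" "e < n" "(n - \<alpha> - b / q) * (q / (q - 1)) \<le> e"
    and \<beta>: "0 < \<beta>" "\<beta> = b - n + \<alpha> * q"
    and D: "1 \<le> D" "\<And>y. y \<in> space M \<Longrightarrow> norm (x - y) < D"
    and H: "weighted_int q b x = ennreal h" "0 \<le> h"
  shows "riesz_int x \<le> ennreal (near_const e D + log_coeff / \<beta> * ln (max 1 h))"
proof -
  \<comment> \<open>the largest radius not exceeding 1 for which the near part is still bounded\<close>
  define \<delta> where "\<delta> = max 1 h powr (- 1 / \<beta>)"
  have \<delta>: "0 < \<delta>" by (simp add: \<delta>_def)
  have "\<delta> \<le> 1 powr (- 1 / \<beta>)"
    unfolding \<delta>_def using \<beta>(1) by (intro powr_mono2') auto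
  then have \<delta>1: "\<delta> \<le> 1" by simp
  have \<delta>h: "\<delta> powr \<beta> * h \<le> 1"
  proof -
    have "- 1 / \<beta> * \<beta> = - 1" using \<beta>(1) by simp
    then have "\<delta> powr \<beta> = max 1 h powr - 1" by (simp only: \<delta>_def powr_powr)
    then have "\<delta> powr \<beta> = 1 / max 1 h" by (simp add: powr_minus_divide)
    then show ?thesis by (simp add: divide_le_eq)
  qed
  have ne: "1 < n / e" using e by simp
  let ?S = "{y \<in> space M. norm (x - y) < \<delta>}" and ?T = "{y. \<delta> \<le> norm (x - y)}"
  let ?k = "\<lambda>y. ennreal (F y * norm (x - y) powr (\<alpha> - n))"
  have "riesz_int x = (\<integral>\<^sup>+ y. ?k y * indicator ?S y + ?k y * indicator ?T y \<partial>M)"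
    unfolding riesz_int_def by (intro nn_integral_cong) (auto split: split_indicator)
  also have "\<dots> = (\<integral>\<^sup>+ y\<in>?S. ?k y \<partial>M) + (\<integral>\<^sup>+ y\<in>?T. ?k y \<partial>M)"
  proof (rule nn_integral_add)
    show "(\<lambda>y. ?k y * indicator ?T y) \<in> borel_measurable M"
      unfolding indicator_def by simp
  qed measurable
  also have "\<dots> \<le> (ennreal (\<delta> powr \<beta>) * ennreal h + ennreal (\<omega> + \<omega> / (n / e - 1)))
      + ennreal (log_coeff / (n - \<alpha>) + log_coeff * ln (D / \<delta>))"
    using near_part_le[OF q e \<delta>, of x] far_part_le[OF \<delta>, of D x] D \<delta>1
    unfolding \<beta>(2)[symmetric] H(1)[unfolded weighted_int_def] by (intro add_mono) auto
  also have "\<dots> = ennreal (\<delta> powr \<beta> * h + (\<omega> + \<omega> / (n / e - 1)) + (log_coeff / (n - \<alpha>) + log_coeff * ln (D / \<delta>)))"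
    using ne H \<delta> \<delta>1 D(1) growth_const_pos log_coeff_pos exponents
    by (simp add: ennreal_mult)
  also have "\<dots> \<le> ennreal (near_const e D + log_coeff / \<beta> * ln (max 1 h))"
  proof (rule ennreal_leI)
    have "ln (D / \<delta>) = ln D + 1 / \<beta> * ln (max 1 h)"
      using D \<delta> \<beta>(1) by (simp add: ln_div \<delta>_def)
    then have "log_coeff * ln (D / \<delta>) = log_coeff * ln D + log_coeff / \<beta> * ln (max 1 h)"
      by (simp add: algebra_simps)
    then show "\<delta> powr \<beta> * h + (\<omega> + \<omega> / (n / e - 1)) + (log_coeff / (n - \<alpha>) + log_coeff * ln (D / \<delta>))
        \<le> near_const e D + log_coeff / \<beta> * ln (max 1 h)"
      using \<delta>h by (simp add: near_const_def)
  qed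
  finally show ?thesis .
qed

text \<open>The coefficient \<open>log_coeff / \<beta>\<close> of the logarithm is exactly
  compensated by the factor \<open>\<beta> / log_coeff\<close>, so exponentiating leaves the first
  power of the weighted integral. An infinite weighted integral makes the right side
  infinite.\<close>

lemma exp_riesz_int_le:
  fixes q b e D :: real
  assumes q: "1 < q" and e: "0 < e" "e < n" "(n - \<alpha> - b / q) * (q / (q - 1)) \<le> e"
    and \<beta>: "0 < \<beta>" "\<beta> = b - n + \<alpha> * q"
    and D: "1 \<le> D" "\<And>y. y \<in> space M \<Longrightarrow> norm (x - y) < D"
  shows "exp_ereal (ereal (\<beta> / log_coeff) * enn2ereal (riesz_int x))
      \<le> ennreal (exp (\<beta> / log_coeff * near_const e D)) * (1 + weighted_int q b x)"
proof (cases "weighted_int q b x")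
  case (real h)
  have L0: "0 < log_coeff" by (rule log_coeff_pos)
  \<comment> \<open>Nonnegativity matters: on negative reals \<open>ennreal\<close> is 0, and the
    bound would not transfer to \<open>ereal\<close>.\<close>
  have K0: "0 \<le> near_const e D + log_coeff / \<beta> * ln (max 1 h)"
    using e D growth_const_pos L0 \<beta> exponents
    by (auto simp: near_const_def intro!: add_nonneg_nonneg mult_nonneg_nonneg divide_nonneg_nonneg)
  have "enn2ereal (riesz_int x) \<le> ereal (near_const e D + log_coeff / \<beta> * ln (max 1 h))"
    using riesz_int_le[OF q e \<beta> D real(2,1)] K0
    by (metis enn2ereal_ennreal less_eq_ennreal.rep_eq)
  then have "ereal (\<beta> / log_coeff) * enn2ereal (riesz_int x)
      \<le> ereal (\<beta> / log_coeff) * ereal (near_const e D + log_coeff / \<beta> * ln (max 1 h))"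
    using \<beta> L0 by (intro ereal_mult_left_mono) auto
  also have "\<dots> = ereal (\<beta> / log_coeff * near_const e D + ln (max 1 h))"
    using \<beta> L0 by (simp add: distrib_left)
  finally have "exp_ereal (ereal (\<beta> / log_coeff) * enn2ereal (riesz_int x))
      \<le> exp_ereal (ereal (\<beta> / log_coeff * near_const e D + ln (max 1 h)))"
    by (rule exp_ereal_mono)
  also have "\<dots> = ennreal (exp (\<beta> / log_coeff * near_const e D) * max 1 h)"
    by (simp add: exp_ereal_def exp_add)
  also have "\<dots> \<le> ennreal (exp (\<beta> / log_coeff * near_const e D) * (1 + h))"
    using real by (intro ennreal_leI mult_left_mono) auto
  also have "\<dots> = ennreal (exp (\<beta> / log_coeff * near_const e D)) * (1 + weighted_int q b x)"
    using real by (simp add: ennreal_mult)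
  finally show ?thesis .
qed (simp add: ennreal_mult_top)

text \<open>Tonelli: for fixed \<open>y\<close> the kernel is integrated over \<open>x\<close>
  first, uniformly in \<open>y\<close> because \<open>b < d\<close>; what is left is the integral of
  \<open>F y powr q\<close>, bounded because \<open>\<alpha> * q < n\<close>. The bound sees
  \<open>\<nu>\<close> only through \<open>N\<close>, \<open>C\<close> and \<open>d\<close>, and
  \<open>F\<close> not at all, which is the uniformity needed.\<close>

lemma nn_integral_exp_riesz_int_le:
  fixes \<nu> :: "'a measure" and q b e D d C N V :: real
  assumes q: "1 < q" "\<alpha> * q < n" and e: "0 < e" "e < n" "(n - \<alpha> - b / q) * (q / (q - 1)) \<le> e"
    and \<beta>: "0 < \<beta>" "\<beta> = b - n + \<alpha> * q" and b: "0 < b" "b < d"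
    and D: "1 \<le> D" "\<And>x y. x \<in> S \<Longrightarrow> y \<in> space M \<Longrightarrow> norm (x - y) < D"
    and \<nu>: "sets \<nu> = sets borel" "emeasure \<nu> (space \<nu>) \<le> ennreal N"
      "\<And>x r. 0 < r \<Longrightarrow> emeasure \<nu> (ball x r) \<le> ennreal (C * r powr d)"
    and pos: "0 \<le> C" "0 \<le> N" "0 \<le> V" and V: "emeasure M (space M) \<le> ennreal V"
  shows "(\<integral>\<^sup>+ x\<in>S. exp_ereal (ereal (\<beta> / log_coeff) * enn2ereal (riesz_int x)) \<partial>\<nu>)
      \<le> ennreal (exp (\<beta> / log_coeff * near_const e D)
          * (N + (N + C / (d / b - 1)) * (V + 1 / (n / (\<alpha> * q) - 1))))"
proof -
  note sigma_finite = sigma_finite_measure_axioms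
  interpret \<nu>: finite_measure \<nu>
    using \<nu>(2) by (intro finite_measureI) (auto simp: top_unique)
  interpret pair_sigma_finite \<nu> M ..
  have sp: "space \<nu> = UNIV" using \<nu>(1) by (metis sets_eq_imp_space_eq space_borel)
  have id\<nu>: "(\<lambda>y. y) \<in> borel_measurable \<nu>" using \<nu>(1) by (simp add: measurable_ident_sets)
  have id1 [measurable]: "fst \<in> borel_measurable (\<nu> \<Otimes>\<^sub>M M)" and id2 [measurable]: "snd \<in> borel_measurable (\<nu> \<Otimes>\<^sub>M M)"
    using measurable_compose[OF measurable_fst id\<nu>] measurable_compose[OF measurable_snd measurable_id] by auto
  let ?E = "exp (\<beta> / log_coeff * near_const e D)" and ?V = "V + 1 / (n / (\<alpha> * q) - 1)" and ?N = "N + C / (d / b - 1)"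
  let ?k = "\<lambda>x y. ennreal (F y powr q * norm (x - y) powr - b)"
  have joint: "(\<lambda>(x, y). ?k x y) \<in> borel_measurable (\<nu> \<Otimes>\<^sub>M M)"
    by (simp add: case_prod_beta)
  have q1: "1 < n / (\<alpha> * q)" using q exponents by simp
  have db: "1 < d / b" using b by simp
  have [measurable]: "weighted_int q b \<in> borel_measurable \<nu>"
    using sigma_finite_measure.borel_measurable_nn_integral_fst[OF sigma_finite joint]
    by (simp add: weighted_int_def[abs_def])
  have "(\<integral>\<^sup>+ x. weighted_int q b x \<partial>\<nu>) = (\<integral>\<^sup>+ y. (\<integral>\<^sup>+ x. ?k x y \<partial>\<nu>) \<partial>M)"
    unfolding weighted_int_def using joint by (rule Fubini'[symmetric])
  also have "\<dots> \<le> (\<integral>\<^sup>+ y. ennreal (F y powr q) * ennreal ?N \<partial>M)"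
  proof (intro nn_integral_mono)
    fix y
    have [measurable]: "(\<lambda>x. norm (x - y)) \<in> borel_measurable \<nu>"
      using measurable_compose[OF id\<nu>, of "\<lambda>x. norm (x - y)" borel] by simp
    have "(\<integral>\<^sup>+ x. ennreal (norm (y - x) powr - b) \<partial>\<nu>) \<le> emeasure \<nu> (space \<nu>) + ennreal (C / (d / b - 1))"
    proof (rule nn_integral_distance_powr_le[OF \<nu>.sigma_finite_measure_axioms id\<nu> _ b pos(1)])
      fix r :: real assume "0 < r"
      have "{x \<in> space \<nu>. norm (y - x) < r} = ball y r" by (auto simp: sp dist_norm)
      then show "emeasure \<nu> {x \<in> space \<nu>. norm (y - x) < r} \<le> ennreal (C * r powr d)"
        using \<nu>(3)[OF \<open>0 < r\<close>] by simp
    qed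
    also have "\<dots> \<le> ennreal ?N"
      using \<nu>(2) pos db by (simp add: add_right_mono)
    finally have "(\<integral>\<^sup>+ x. ennreal (norm (x - y) powr - b) \<partial>\<nu>) \<le> ennreal ?N"
      by (simp add: norm_minus_commute)
    then show "(\<integral>\<^sup>+ x. ?k x y \<partial>\<nu>) \<le> ennreal (F y powr q) * ennreal ?N"
      by (simp add: ennreal_mult nn_integral_cmult mult_left_mono)
  qed
  also have "\<dots> = (\<integral>\<^sup>+ y. ennreal (F y powr q) \<partial>M) * ennreal ?N"
    by (rule nn_integral_multc) simp
  also have "\<dots> \<le> ennreal ?V * ennreal ?N"
  proof (rule mult_right_mono)
    have "(\<integral>\<^sup>+ y. ennreal (F y powr q) \<partial>M) \<le> emeasure M (space M) + ennreal (1 / (n / (\<alpha> * q) - 1))"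
      using q by (intro nn_integral_density_powr_le) auto
    also have "\<dots> \<le> ennreal ?V"
      using V pos q1 by (simp add: ennreal_plus add_right_mono)
    finally show "(\<integral>\<^sup>+ y. ennreal (F y powr q) \<partial>M) \<le> ennreal ?V" .
  qed simp
  finally have W: "(\<integral>\<^sup>+ x. weighted_int q b x \<partial>\<nu>) \<le> ennreal ?V * ennreal ?N" .
  have "(\<integral>\<^sup>+ x\<in>S. exp_ereal (ereal (\<beta> / log_coeff) * enn2ereal (riesz_int x)) \<partial>\<nu>)
      \<le> (\<integral>\<^sup>+ x. ennreal ?E * (1 + weighted_int q b x) \<partial>\<nu>)"
  proof (intro nn_integral_mono)
    fix x
    show "exp_ereal (ereal (\<beta> / log_coeff) * enn2ereal (riesz_int x)) * indicator S x
        \<le> ennreal ?E * (1 + weighted_int q b x)"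
      using exp_riesz_int_le[OF q(1) e \<beta> D(1), of x] D(2)[of x] by (cases "x \<in> S") auto
  qed
  also have "\<dots> = ennreal ?E * (emeasure \<nu> (space \<nu>) + (\<integral>\<^sup>+ x. weighted_int q b x \<partial>\<nu>))"
    by (simp add: nn_integral_cmult nn_integral_add)
  also have "\<dots> \<le> ennreal ?E * (ennreal N + ennreal ?V * ennreal ?N)"
    using \<nu>(2) W by (intro mult_left_mono add_mono) auto
  also have "\<dots> = ennreal (?E * (N + ?N * ?V))"
    using pos db q1 by (simp add: ennreal_mult mult.commute)
  finally show ?thesis .
qed

end

section \<open>Weak Lebesgue spaces and the subcritical bound\<close>

lemma emeasure_lebesgue_ball:
  fixes x :: "'a::euclidean_space"
  assumes "0 \<le> r"
  shows "emeasure lebesgue (ball x r) = ennreal (measure lebesgue (ball (0::'a) 1) * r ^ DIM('a))"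
  using emeasure_ball[OF assms, of x] content_ball[of 1 "0::'a"] by simp

text \<open>If the tail exceeded \<open>s powr - p\<close>, pick \<open>t\<close> strictly between.
  Then \<open>t\<close> lies below the measure of \<open>\<Omega>\<close>, so the norm bounds the
  rearrangement at \<open>t\<close> by \<open>t powr (- 1 / p) < s\<close>. Some level
  \<open>l < s\<close> thus has tail at most \<open>t\<close>, contradicting monotonicity of
  tails.\<close>

lemma weak_norm_tail:
  fixes f :: "real^'n \<Rightarrow> real"
  assumes \<Omega>: "\<Omega> \<in> sets lebesgue" and f: "f \<in> borel_measurable (lebesgue_on \<Omega>)"
    and p: "0 < p" and norm: "weak_norm \<Omega> p (\<lambda>x. \<bar>f x\<bar>) \<le> 1" and s: "0 < s"
  shows "emeasure lebesgue {y \<in> \<Omega>. s < \<bar>f y\<bar>} \<le> ennreal (s powr - p)"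
proof (rule ccontr)
  have sets: "{y \<in> \<Omega>. l < \<bar>f y\<bar>} \<in> sets lebesgue" for l
  proof -
    have "{y \<in> space (lebesgue_on \<Omega>). l < \<bar>f y\<bar>} \<in> sets (lebesgue_on \<Omega>)"
      using f by measurable
    then show ?thesis using \<Omega> by (simp add: sets_restrict_space_iff space_restrict_space)
  qed
  assume "\<not> ?thesis"
  then obtain t' where t': "ennreal (s powr - p) < t'" "t' < emeasure lebesgue {y \<in> \<Omega>. s < \<bar>f y\<bar>}"
    using dense by (auto simp: not_le)
  then obtain t where t: "t' = ennreal t" "0 \<le> t" by (cases t') auto
  have st: "s powr - p < t" using t' t by (simp add: ennreal_less_iff)
  moreover have "0 < s powr - p" using s by simp
  ultimately have t0: "0 < t" by linarith
  have "emeasure lebesgue {y \<in> \<Omega>. s < \<bar>f y\<bar>} \<le> emeasure lebesgue \<Omega>"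
    using \<Omega> by (intro emeasure_mono) auto
  then have "ennreal t < emeasure lebesgue \<Omega>" using t' t by auto
  then have "ennreal (t powr (1 / p)) * rearrangement \<Omega> (\<lambda>x. \<bar>f x\<bar>) t \<le> weak_norm \<Omega> p (\<lambda>x. \<bar>f x\<bar>)"
    unfolding weak_norm_def using t0 by (intro SUP_upper2[of t]) auto
  also have "\<dots> \<le> 1" by (rule norm)
  finally have le1: "ennreal (t powr (1 / p)) * rearrangement \<Omega> (\<lambda>x. \<bar>f x\<bar>) t \<le> 1" .
  have "rearrangement \<Omega> (\<lambda>x. \<bar>f x\<bar>) t < ennreal s"
  proof (rule ccontr)
    assume "\<not> ?thesis"
    then have "ennreal (t powr (1 / p)) * ennreal s \<le> ennreal (t powr (1 / p)) * rearrangement \<Omega> (\<lambda>x. \<bar>f x\<bar>) t"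
      by (intro mult_left_mono) auto
    then have "ennreal (t powr (1 / p) * s) \<le> ennreal 1"
      using le1 s by (simp add: ennreal_mult)
    then have "t powr (1 / p) * s \<le> 1" by (subst (asm) ennreal_le_iff) auto
    moreover have "(s powr - p) powr (1 / p) < t powr (1 / p)"
      using st s p by (intro powr_less_mono2) auto
    then have "1 / s < t powr (1 / p)"
      unfolding powr_powr using s p by (simp add: powr_minus_divide)
    then have "1 < t powr (1 / p) * s"
      using s by (simp add: divide_less_eq)
    ultimately show False by simp
  qed
  then obtain l where l: "ennreal l < ennreal s" "l > 0" "emeasure lebesgue {x \<in> \<Omega>. \<bar>\<bar>f x\<bar>\<bar> > l} \<le> ennreal t"
    unfolding rearrangement_def Inf_less_iff by auto
  have "emeasure lebesgue {y \<in> \<Omega>. s < \<bar>f y\<bar>} \<le> emeasure lebesgue {x \<in> \<Omega>. \<bar>f x\<bar> > l}"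
    using l s sets by (intro emeasure_mono) (auto simp: ennreal_less_iff)
  then show False using l t t' by auto
qed

section \<open>Reduction of Riesz potentials to the abstract setting\<close>

lemma riesz_const_pos:
  assumes "0 < \<alpha>" "\<alpha> < real CARD('n)"
  shows "0 < riesz_const TYPE('n::finite) \<alpha>"
  using assms by (simp add: riesz_const_def Gamma_real_pos)

lemma weak_type_density_lebesgue_on:
  fixes \<Omega> :: "(real^'n) set"
  assumes "open \<Omega>" "bounded \<Omega>" "0 < \<alpha>" "\<alpha> < real CARD('n)"
    and f: "f \<in> weak_Lp \<Omega> (real CARD('n) / \<alpha>)" "weak_norm \<Omega> (real CARD('n) / \<alpha>) (\<lambda>x. \<bar>f x\<bar>) \<le> 1"
  shows "weak_type_density (lebesgue_on \<Omega>) (\<lambda>y. \<bar>f y\<bar>) (real CARD('n)) \<alpha> (measure lebesgue (ball (0::real^'n) 1))"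
proof -
  have \<Omega>: "\<Omega> \<in> lmeasurable" using assms by (simp add: lmeasurable_open)
  then have \<Omega>s: "\<Omega> \<in> sets lebesgue" by auto
  have fm: "f \<in> borel_measurable (lebesgue_on \<Omega>)" using f by (simp add: weak_Lp_def)
  interpret finite_measure "lebesgue_on \<Omega>"
    by (rule finite_measure_lebesgue_on[OF \<Omega>])
  show ?thesis
  proof
    show "(\<lambda>y. y) \<in> borel_measurable (lebesgue_on \<Omega>)"
      by (intro measurable_restrict_space1) (simp add: measurable_completion)
    show "(\<lambda>y. \<bar>f y\<bar>) \<in> borel_measurable (lebesgue_on \<Omega>)" using fm by measurable
    fix s :: real assume s: "0 < s"
    show "emeasure (lebesgue_on \<Omega>) {y \<in> space (lebesgue_on \<Omega>). s < \<bar>f y\<bar>} \<le> ennreal (s powr - (real CARD('n) / \<alpha>))"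
      using weak_norm_tail[OF \<Omega>s fm _ f(2) s] assms \<Omega>s
      by (subst emeasure_restrict_space) (auto simp: space_restrict_space)
  next
    fix r :: real and x :: "real^'n" assume r: "0 < r"
    have "emeasure (lebesgue_on \<Omega>) {y \<in> space (lebesgue_on \<Omega>). norm (x - y) < r}
        = emeasure lebesgue {y \<in> \<Omega>. norm (x - y) < r}"
      using \<Omega>s by (subst emeasure_restrict_space) (auto simp: space_restrict_space)
    also have "\<dots> \<le> emeasure lebesgue (ball x r)"
      by (intro emeasure_mono) (auto simp: dist_norm)
    also have "\<dots> = ennreal (measure lebesgue (ball (0::real^'n) 1) * r powr real CARD('n))"
      using emeasure_lebesgue_ball[of r x] r by (simp add: powr_realpow)
    finally show "emeasure (lebesgue_on \<Omega>) {y \<in> space (lebesgue_on \<Omega>). norm (x - y) < r}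
        \<le> ennreal (measure lebesgue (ball (0::real^'n) 1) * r powr real CARD('n))" .
  next
    show "0 < measure lebesgue (ball (0::real^'n) 1)" by simp
  qed (use assms in auto)
qed

text \<open>Positive and negative parts of the potential are both dominated by the integral of
  \<open>\<bar>f\<bar>\<close> against the kernel, hence so is their difference.\<close>

lemma abs_riesz_potential_le:
  fixes \<Omega> :: "(real^'n) set"
  assumes "\<Omega> \<in> sets lebesgue" "0 < \<alpha>" "\<alpha> < real CARD('n)"
  shows "\<bar>riesz_potential \<alpha> (zero_extension \<Omega> f) x\<bar>
    \<le> ereal (1 / riesz_const TYPE('n) \<alpha>)
       * enn2ereal (\<integral>\<^sup>+ y. ennreal (\<bar>f y\<bar> * norm (x - y) powr (\<alpha> - real CARD('n))) \<partial>lebesgue_on \<Omega>)"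
proof -
  define R where "R = (\<integral>\<^sup>+ y. ennreal (\<bar>f y\<bar> * norm (x - y) powr (\<alpha> - real CARD('n))) \<partial>lebesgue_on \<Omega>)"
  have R: "R = (\<integral>\<^sup>+ y. ennreal (\<bar>f y\<bar> * norm (x - y) powr (\<alpha> - real CARD('n))) * indicator \<Omega> y \<partial>lebesgue)"
    unfolding R_def using assms by (intro nn_integral_restrict_space) auto
  \<comment> \<open>True at \<open>y = x\<close> as well, where both sides are 0 by the conventions
    for \<open>powr\<close> and division.\<close>
  have kernel: "norm (x - y) powr (\<alpha> - real CARD('n)) = 1 / norm (x - y) powr (real CARD('n) - \<alpha>)" for y
    by (simp add: powr_diff)
  define P where "P = (\<integral>\<^sup>+ y. ennreal (zero_extension \<Omega> f y / norm (x - y) powr (real CARD('n) - \<alpha>)) \<partial>lebesgue)"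
  define N where "N = (\<integral>\<^sup>+ y. ennreal (- zero_extension \<Omega> f y / norm (x - y) powr (real CARD('n) - \<alpha>)) \<partial>lebesgue)"
  have le: "s * zero_extension \<Omega> f y / norm (x - y) powr (real CARD('n) - \<alpha>)
      \<le> \<bar>f y\<bar> * (1 / norm (x - y) powr (real CARD('n) - \<alpha>))" if "s = 1 \<or> s = - 1" for s y
    using that by (auto simp: zero_extension_def divide_inverse simp flip: minus_mult_left
      intro!: mult_right_mono)
  have "P \<le> R"
    unfolding P_def R kernel
  proof (intro nn_integral_mono)
    fix y show "ennreal (zero_extension \<Omega> f y / norm (x - y) powr (real CARD('n) - \<alpha>))
      \<le> ennreal (\<bar>f y\<bar> * (1 / norm (x - y) powr (real CARD('n) - \<alpha>))) * indicator \<Omega> y"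
      using le[of 1 y] by (cases "y \<in> \<Omega>") (auto simp: zero_extension_def intro: ennreal_leI)
  qed
  moreover have "N \<le> R"
    unfolding N_def R kernel
  proof (intro nn_integral_mono)
    fix y show "ennreal (- zero_extension \<Omega> f y / norm (x - y) powr (real CARD('n) - \<alpha>))
      \<le> ennreal (\<bar>f y\<bar> * (1 / norm (x - y) powr (real CARD('n) - \<alpha>))) * indicator \<Omega> y"
      using le[of "- 1" y] by (cases "y \<in> \<Omega>") (auto simp: zero_extension_def intro: ennreal_leI)
  qed
  ultimately have le: "enn2ereal P \<le> enn2ereal R" "enn2ereal N \<le> enn2ereal R"
    by (simp_all add: less_eq_ennreal.rep_eq)
  have pos: "0 \<le> enn2ereal P" "0 \<le> enn2ereal N" by simp_all
  \<comment> \<open>If \<open>P\<close> and \<open>N\<close> are both infinite, their difference is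
    \<infinity> by convention, but then \<open>R\<close> is infinite too.\<close>
  have "\<bar>enn2ereal P - enn2ereal N\<bar> \<le> enn2ereal R"
    using le pos by (cases "enn2ereal P"; cases "enn2ereal N"; cases "enn2ereal R") auto
  moreover have "riesz_potential \<alpha> (zero_extension \<Omega> f) x = ereal (1 / riesz_const TYPE('n) \<alpha>) * (enn2ereal P - enn2ereal N)"
    by (simp add: riesz_potential_def P_def N_def)
  ultimately show ?thesis
    using riesz_const_pos[OF assms(2,3)]
    by (simp add: R_def[symmetric] ereal_abs_mult ereal_mult_left_mono)
qed

text \<open>Puts the critical exponent in the form to be compared with \<open>\<beta> / L\<close>:
  \<open>d / L\<close> times the normalising constant of the potential.\<close>

lemma critical_const_eq:
  fixes \<alpha> d :: real
  assumes "0 < \<alpha>" "\<alpha> < real CARD('n::finite)"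
  defines "\<omega> \<equiv> measure lebesgue (ball (0 :: real^'n) 1)"
  shows "critical_const TYPE('n) \<alpha> d
    = d / (real CARD('n) * \<omega> powr (1 - \<alpha> / real CARD('n))) * riesz_const TYPE('n) \<alpha>"
proof -
  have "- (real CARD('n) - \<alpha>) / real CARD('n) = - (1 - \<alpha> / real CARD('n))" by (simp add: field_simps)
  then have "\<omega> powr (- (real CARD('n) - \<alpha>) / real CARD('n)) = 1 / \<omega> powr (1 - \<alpha> / real CARD('n))"
    by (simp only: powr_minus_divide)
  then show ?thesis
    by (simp add: critical_const_def \<omega>_def)
qed

text \<open>\<open>\<gamma>\<close> may be negative, so it is first replaced by a nonnegative
  multiple of \<open>riesz_const\<close>, whose factor cancels the normalisation of the
  potential.\<close>

lemma exp_integral_le_riesz_int: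
  fixes \<Omega> :: "(real^'n) set"
  assumes "\<Omega> \<in> sets lebesgue" "0 < \<alpha>" "\<alpha> < real CARD('n)"
    and \<kappa>: "0 \<le> \<kappa>" "\<gamma> \<le> \<kappa> * riesz_const TYPE('n) \<alpha>"
  shows "exp_integral \<Omega> \<nu> \<alpha> \<gamma> f \<le> (\<integral>\<^sup>+ x\<in>\<Omega>. exp_ereal (ereal \<kappa>
       * enn2ereal (\<integral>\<^sup>+ y. ennreal (\<bar>f y\<bar> * norm (x - y) powr (\<alpha> - real CARD('n))) \<partial>lebesgue_on \<Omega>)) \<partial>\<nu>)"
  unfolding exp_integral_def
proof (intro nn_integral_mono mult_right_mono exp_ereal_mono)
  fix x
  let ?P = "\<bar>riesz_potential \<alpha> (zero_extension \<Omega> f) x\<bar>" and ?rc = "riesz_const TYPE('n) \<alpha>"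
  let ?R = "enn2ereal (\<integral>\<^sup>+ y. ennreal (\<bar>f y\<bar> * norm (x - y) powr (\<alpha> - real CARD('n))) \<partial>lebesgue_on \<Omega>)"
  have rc: "0 < ?rc" by (rule riesz_const_pos[OF assms(2,3)])
  have "ereal \<gamma> * ?P \<le> ereal (\<kappa> * ?rc) * ?P"
    using \<kappa> by (intro ereal_mult_right_mono) auto
  also have "\<dots> \<le> ereal (\<kappa> * ?rc) * (ereal (1 / ?rc) * ?R)"
    using \<kappa> rc by (intro ereal_mult_left_mono abs_riesz_potential_le assms) auto
  also have "\<dots> = ereal \<kappa> * ?R"
    using rc by (simp add: mult.assoc[symmetric])
  finally show "ereal \<gamma> * ?P \<le> ereal \<kappa> * ?R" .
qed simp

section \<open>The uniform bound below the critical exponent\<close>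

lemma subcritical_exp_integral_bounded:
  fixes \<Omega> :: "(real^'n) set" and \<alpha> d :: real
  assumes \<Omega>: "open \<Omega>" "bounded \<Omega>" and \<alpha>: "0 < \<alpha>" "\<alpha> < real CARD('n)" and d: "0 < d"
    and C\<^sub>d: "0 < C\<^sub>d" and \<gamma>: "\<gamma> < critical_const TYPE('n) \<alpha> d"
  shows "\<exists>C::real. C > 0 \<and> (\<forall>\<nu>. borel_measure_on \<Omega> \<nu> \<and> upper_growth \<nu> d C\<^sub>d \<longrightarrow>
     (\<forall>f \<in> weak_Lp \<Omega> (real CARD('n) / \<alpha>). weak_norm \<Omega> (real CARD('n) / \<alpha>) (\<lambda>x. \<bar>f x\<bar>) \<le> 1 \<longrightarrow>
        exp_integral \<Omega> \<nu> \<alpha> \<gamma> f \<le> ennreal C))"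
proof -
  define n where "n = real CARD('n)"
  define \<omega> where "\<omega> = measure lebesgue (ball (0::real^'n) 1)"
  define rc where "rc = riesz_const TYPE('n) \<alpha>"
  define L where "L = n * \<omega> powr (1 - \<alpha> / n)"
  have n0: "0 < n" and an: "\<alpha> < n" using \<alpha> by (auto simp: n_def)
  have \<omega>0: "0 < \<omega>" by (simp add: \<omega>_def)
  have L0: "0 < L" using n0 \<omega>0 by (simp add: L_def)
  have rc0: "0 < rc" unfolding rc_def by (rule riesz_const_pos[OF \<alpha>])
  have "\<gamma> < d / L * rc"
    using \<gamma> critical_const_eq[OF \<alpha>, of d] by (simp add: L_def n_def \<omega>_def rc_def)
  then have \<gamma>d: "\<gamma> * L / rc < d" using L0 rc0 by (simp add: field_simps)
  define g where "g = \<gamma> * L / rc"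
  \<comment> \<open>\<open>(d - g) / 2\<close> makes \<open>\<beta> = d - 2 * m\<close> at least
    \<open>g\<close>, \<open>d / 4\<close> keeps \<open>\<beta>\<close> and \<open>b\<close>
    positive, and \<open>(n - \<alpha>) / 2\<close> keeps \<open>q > 1\<close>.\<close>
  define m where "m = min (min ((d - g) / 2) (d / 4)) ((n - \<alpha>) / 2)"
  have m: "0 < m" "m < n - \<alpha>" "2 * m < d" "2 * m \<le> d - \<gamma> * L / rc"
    using \<gamma>d d an unfolding g_def[symmetric] by (auto simp: m_def min_def)
  \<comment> \<open>\<open>q\<close> is slightly below \<open>n / \<alpha>\<close> and \<open>b\<close> slightly below \<open>d\<close>, arranged so that \<open>\<beta>\<close> is still at
    least \<open>\<gamma> * L / rc\<close>; this is where subcriticality enters\<close>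
  define q where "q = (n - m) / \<alpha>"
  define b where "b = d - m"
  define \<beta> where "\<beta> = d - 2 * m"
  have aq: "\<alpha> * q = n - m" using \<alpha> by (simp add: q_def)
  have q: "1 < q" "\<alpha> * q < n" using m \<alpha> aq by (auto simp: q_def)
  have \<beta>: "0 < \<beta>" "\<beta> = b - n + \<alpha> * q" using m aq by (auto simp: \<beta>_def b_def)
  have b: "0 < b" "b < d" using m by (auto simp: b_def)
  \<comment> \<open>The exponent needed for the conjugate term is below \<open>n\<close> exactly
    because \<open>\<beta> > 0\<close>, that is \<open>n < b + \<alpha> * q\<close>; the maximum
    with \<open>n / 2\<close> makes it positive.\<close>
  define e where "e = max ((n - \<alpha> - b / q) * (q / (q - 1))) (n / 2)"
  have "(n - \<alpha> - b / q) * (q / (q - 1)) = (n * q - \<alpha> * q - b) / (q - 1)"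
    using q by (simp add: field_simps)
  also have "\<dots> < n"
    using q \<beta> by (simp add: field_simps)
  finally have e: "0 < e" "e < n" "(n - \<alpha> - b / q) * (q / (q - 1)) \<le> e"
    using n0 by (auto simp: e_def)
  obtain a where a: "\<And>x. x \<in> \<Omega> \<Longrightarrow> norm x \<le> a" using \<Omega>(2) by (auto simp: bounded_iff)
  \<comment> \<open>\<open>D\<close> exceeds the distance between any two points of
    \<open>\<Omega>\<close>, and \<open>\<Omega>\<close> lies in \<open>ball 0 D\<close>, so growth
    at radius \<open>D\<close> also bounds the total mass.\<close>
  define D where "D = 2 * \<bar>a\<bar> + 1"
  have D: "1 \<le> D" "norm (x - y) < D" if "x \<in> \<Omega>" "y \<in> \<Omega>" for x y
    using a[OF that(1)] a[OF that(2)] norm_triangle_ineq4[of x y] by (auto simp: D_def)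
  have D1: "1 \<le> D" by (simp add: D_def)
  define N where "N = C\<^sub>d * D powr d"
  define V where "V = measure lebesgue \<Omega>"
  \<comment> \<open>Fixed before \<open>\<nu>\<close> and \<open>f\<close>: it depends only on the
    dimension, \<open>\<alpha>\<close>, \<open>d\<close>, \<open>\<Omega>\<close>,
    \<open>C\<^sub>d\<close> and \<open>\<gamma>\<close>.\<close>
  define K where "K = exp (\<beta> / L * weak_type_density.near_const n \<alpha> \<omega> e D)
     * (N + (N + C\<^sub>d / (d / b - 1)) * (V + 1 / (n / (\<alpha> * q) - 1)))"
  have "exp_integral \<Omega> \<nu> \<alpha> \<gamma> f \<le> ennreal (\<bar>K\<bar> + 1)"
    if \<nu>: "borel_measure_on \<Omega> \<nu>" "upper_growth \<nu> d C\<^sub>d"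
      and f: "f \<in> weak_Lp \<Omega> (real CARD('n) / \<alpha>)" "weak_norm \<Omega> (real CARD('n) / \<alpha>) (\<lambda>x. \<bar>f x\<bar>) \<le> 1"
    for \<nu> f
  proof -
    interpret weak_type_density "lebesgue_on \<Omega>" "\<lambda>y. \<bar>f y\<bar>" n \<alpha> \<omega>
      unfolding n_def \<omega>_def using \<Omega> \<alpha> f by (rule weak_type_density_lebesgue_on)
    have Ll: "log_coeff = L" by (simp add: log_coeff_def L_def)
    have \<Omega>s: "\<Omega> \<in> lmeasurable" using \<Omega> by (simp add: lmeasurable_open)
    have sets\<nu>: "sets \<nu> = sets borel" using \<nu> by (simp add: borel_measure_on_def)
    have sp\<nu>: "space \<nu> = UNIV" using sets\<nu> by (metis sets_eq_imp_space_eq space_borel)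
    have ball: "emeasure \<nu> (ball x r) \<le> ennreal (C\<^sub>d * r powr d)" if "0 < r" for x r
      using \<nu>(2) that by (auto simp: upper_growth_def)
    have mass: "emeasure \<nu> (space \<nu>) \<le> ennreal N"
    proof -
      have "emeasure \<nu> (space \<nu>) = emeasure \<nu> (\<Omega> \<union> - \<Omega>)" by (simp add: sp\<nu>)
      also have "\<dots> \<le> emeasure \<nu> \<Omega> + emeasure \<nu> (- \<Omega>)"
        using \<Omega> sets\<nu> by (intro emeasure_subadditive) auto
      also have "\<dots> = emeasure \<nu> \<Omega>" using \<nu> by (simp add: borel_measure_on_def)
      also have "\<dots> \<le> emeasure \<nu> (ball 0 D)"
        using a sets\<nu> by (intro emeasure_mono) (fastforce simp: D_def)+
      also have "\<dots> \<le> ennreal N" unfolding N_def using D1 by (intro ball) simp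
      finally show ?thesis .
    qed
    have "exp_integral \<Omega> \<nu> \<alpha> \<gamma> f \<le> (\<integral>\<^sup>+ x\<in>\<Omega>. exp_ereal (ereal (\<beta> / L)
       * enn2ereal (\<integral>\<^sup>+ y. ennreal (\<bar>f y\<bar> * norm (x - y) powr (\<alpha> - real CARD('n))) \<partial>lebesgue_on \<Omega>)) \<partial>\<nu>)"
    proof (rule exp_integral_le_riesz_int)
      show "\<gamma> \<le> \<beta> / L * riesz_const TYPE('n) \<alpha>"
        using m(4) L0 rc0 unfolding rc_def[symmetric] \<beta>_def by (simp add: field_simps)
    qed (use \<Omega>s \<alpha> \<beta> L0 in auto)
    also have "\<dots> = (\<integral>\<^sup>+ x\<in>\<Omega>. exp_ereal (ereal (\<beta> / log_coeff) * enn2ereal (riesz_int x)) \<partial>\<nu>)"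
      unfolding riesz_int_def Ll by (simp add: n_def)
    also have "\<dots> \<le> ennreal K"
      unfolding K_def Ll[symmetric]
    proof (rule nn_integral_exp_riesz_int_le[OF q e \<beta> b D1 _ sets\<nu> mass ball])
      show "emeasure (lebesgue_on \<Omega>) (space (lebesgue_on \<Omega>)) \<le> ennreal V"
        using \<Omega>s by (simp add: V_def emeasure_restrict_space space_restrict_space emeasure_eq_measure2 fmeasurableD)
    qed (use D C\<^sub>d in \<open>auto simp: N_def V_def space_restrict_space\<close>)
    also have "\<dots> \<le> ennreal (\<bar>K\<bar> + 1)" by (intro ennreal_leI) simp
    finally show ?thesis .
  qed
  then show ?thesis by (intro exI[of _ "\<bar>K\<bar> + 1"]) auto
qed

section \<open>Sharpness\<close>

lemma ennreal_eq_top_if_unbounded: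
  assumes "\<And>k. 0 < k \<Longrightarrow> ennreal k \<le> x"
  shows "x = \<infinity>"
proof (cases x)
  case (real r)
  then show ?thesis using assms[of "r + 1"] by (simp add: ennreal_le_iff)
qed simp

text \<open>The kernel exceeds \<open>s\<close> on the ball of radius
  \<open>s powr (- 1 / n) - \<rho>\<close>, whose volume is
  \<open>\<omega> / s * (1 - \<rho> * s powr (1 / n)) ^ DIM('a)\<close>. Bernoulli's inequality
  bounds this below by \<open>\<phi> s\<close>, and integrating \<open>\<phi>\<close> gives the
  sharp logarithm with a bounded loss.\<close>

lemma nn_integral_shifted_distance_ge:
  fixes x\<^sub>0 :: "'a::euclidean_space" and \<rho> R :: real
  defines "n \<equiv> real DIM('a)" and "\<omega> \<equiv> measure lebesgue (ball (0::'a) 1)"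
  assumes \<rho>: "0 < \<rho>" "n * \<rho> \<le> R"
  shows "ennreal (\<omega> * n * (ln (R / (n * \<rho>)) - 1))
    \<le> (\<integral>\<^sup>+ y\<in>ball x\<^sub>0 R. ennreal ((norm (x\<^sub>0 - y) + \<rho>) powr - n) \<partial>lborel)"
proof -
  have n1: "1 \<le> n" by (simp add: n_def Suc_leI)
  have \<omega>0: "0 < \<omega>" by (simp add: \<omega>_def)
  have n\<rho>: "0 < n * \<rho>" using n1 \<rho> by simp
  have R0: "0 < R" using n\<rho> \<rho> by linarith
  \<comment> \<open>\<open>a\<close> is the level for which the unshifted radius is
    \<open>R\<close>, and \<open>b\<close> the level at which the Bernoulli bound
    \<open>\<phi>\<close> drops to 0.\<close>
  define a where "a = R powr - n"
  define b where "b = (n * \<rho>) powr - n"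
  have a0: "0 < a" using R0 by (simp add: a_def)
  have ab: "a \<le> b" unfolding a_def b_def using n1 n\<rho> \<rho> by (intro powr_mono2') auto
  define g where "g y = (norm (x\<^sub>0 - y) + \<rho>) powr - n" for y
  define \<phi> where "\<phi> s = \<omega> * (1 / s - n * \<rho> * s powr (1 / n - 1))" for s
  define \<Phi> where "\<Phi> s = \<omega> * (ln s - n * n * \<rho> * s powr (1 / n))" for s
  have b_root: "n * \<rho> * s powr (1 / n) \<le> 1" if "0 < s" "s \<le> b" for s
  proof -
    have "s powr (1 / n) \<le> b powr (1 / n)" using that n1 by (intro powr_mono2) auto
    also have "b powr (1 / n) = 1 / (n * \<rho>)"
      unfolding b_def powr_powr using n1 n\<rho> by (simp add: powr_minus_divide)
    finally show ?thesis using n\<rho> by (simp add: field_simps)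
  qed
  have \<phi>: "0 \<le> \<phi> s" "\<phi> s = \<omega> * (1 / s) * (1 - n * \<rho> * s powr (1 / n))" if "0 < s" "s \<le> b" for s
  proof -
    show eq: "\<phi> s = \<omega> * (1 / s) * (1 - n * \<rho> * s powr (1 / n))"
      using that by (simp add: \<phi>_def powr_diff field_simps)
    show "0 \<le> \<phi> s" unfolding eq using b_root[OF that] that \<omega>0 by simp
  qed
  have "(\<integral>\<^sup>+ s. ennreal (\<phi> s) * indicator {a..b} s \<partial>lborel) = ennreal (\<Phi> b - \<Phi> a)"
  proof (rule nn_integral_FTC_Icc)
    fix s assume s: "s \<in> {a..b}"
    then have s0: "0 < s" using a0 by simp
    have "DERIV \<Phi> s :> \<omega> * (1 / s - n * n * \<rho> * (1 / n * s powr (1 / n - 1)))"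
      unfolding \<Phi>_def using s0
      by (intro DERIV_cmult DERIV_diff has_real_derivative_powr DERIV_ln_divide)
    moreover have "\<omega> * (1 / s - n * n * \<rho> * (1 / n * s powr (1 / n - 1))) = \<phi> s"
      using n1 by (simp add: \<phi>_def)
    ultimately show "DERIV \<Phi> s :> \<phi> s" by simp
    show "0 \<le> \<phi> s" using \<phi> s s0 by simp
  qed (use ab in \<open>auto simp: \<phi>_def[abs_def]\<close>)
  \<comment> \<open>The correction term of \<open>\<Phi>\<close> is at most \<open>n\<close> at
    \<open>b\<close> and has the favourable sign at \<open>a\<close>; this is where the summand -1
    comes from.\<close>
  moreover have "\<omega> * n * (ln (R / (n * \<rho>)) - 1) \<le> \<Phi> b - \<Phi> a"
  proof -
    have "n * \<rho> * b powr (1 / n) \<le> 1" using a0 ab by (intro b_root) auto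
    then have "n * (n * \<rho> * b powr (1 / n)) \<le> n * 1" using n1 by (intro mult_left_mono) auto
    moreover have "0 \<le> n * n * \<rho> * a powr (1 / n)" using n1 \<rho> by simp
    moreover have "ln b - ln a = n * ln (R / (n * \<rho>))"
    proof -
      have "R \<noteq> 0" "n \<noteq> 0" "\<rho> \<noteq> 0" using R0 n1 \<rho> by auto
      then show ?thesis
        using n1 by (simp add: a_def b_def ln_div ln_mult right_diff_distrib)
    qed
    ultimately have "n * (ln (R / (n * \<rho>)) - 1)
        \<le> (ln b - n * n * \<rho> * b powr (1 / n)) - (ln a - n * n * \<rho> * a powr (1 / n))"
      by (simp add: algebra_simps)
    then have "\<omega> * (n * (ln (R / (n * \<rho>)) - 1))
        \<le> \<omega> * ((ln b - n * n * \<rho> * b powr (1 / n)) - (ln a - n * n * \<rho> * a powr (1 / n)))"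
      using \<omega>0 by (intro mult_left_mono) auto
    then show ?thesis by (simp add: \<Phi>_def algebra_simps)
  qed
  ultimately have "ennreal (\<omega> * n * (ln (R / (n * \<rho>)) - 1)) \<le> (\<integral>\<^sup>+ s. ennreal (\<phi> s) * indicator {a..b} s \<partial>lborel)"
    by (simp add: ennreal_leI)
  also have "\<dots> \<le> (\<integral>\<^sup>+ s. (\<integral>\<^sup>+ y. indicator (ball x\<^sub>0 R) y * indicator {s<..} (g y) \<partial>lborel) * indicator {a<..} s \<partial>lborel)"
  proof (rule nn_integral_mono_AE)
    have "AE s in lborel. s \<noteq> a" by (rule AE_lborel_singleton)
    then show "AE s in lborel. ennreal (\<phi> s) * indicator {a..b} s
        \<le> (\<integral>\<^sup>+ y. indicator (ball x\<^sub>0 R) y * indicator {s<..} (g y) \<partial>lborel) * indicator {a<..} s"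
    proof eventually_elim
      case (elim s)
      show ?case
      proof (cases "s \<in> {a..b}")
        case True
        then have s: "a < s" "s \<le> b" and s0: "0 < s" using elim a0 by auto
        define r where "r = s powr (- 1 / n) - \<rho>"
        have root: "s powr (- 1 / n) * s powr (1 / n) = 1" using s0 by (simp flip: powr_add)
        have "\<rho> * s powr (1 / n) \<le> n * \<rho> * s powr (1 / n)"
          using n1 \<rho> by (intro mult_right_mono) auto
        also have "\<dots> \<le> 1" by (rule b_root[OF s0 s(2)])
        finally have \<rho>s: "\<rho> * s powr (1 / n) \<le> 1" .
        then have "\<rho> * s powr (1 / n) \<le> s powr (- 1 / n) * s powr (1 / n)" using root by simp
        then have r0: "0 \<le> r" using s0 by (simp add: r_def)
        have "s powr (- 1 / n) \<le> a powr (- 1 / n)"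
          using s a0 n1 by (intro powr_mono2') auto
        also have "\<dots> = R" using R0 n1 by (simp add: a_def powr_powr)
        finally have rR: "r \<le> R" using \<rho> by (simp add: r_def)
        have sub: "y \<in> ball x\<^sub>0 R \<and> s < g y" if "y \<in> ball x\<^sub>0 r" for y
        proof -
          have "norm (x\<^sub>0 - y) + \<rho> < s powr (- 1 / n)" using that by (simp add: r_def dist_norm)
          then have "(s powr (- 1 / n)) powr - n < g y"
            unfolding g_def using n1 \<rho> by (intro powr_less_mono2_neg) (auto intro: add_nonneg_pos)
          then show ?thesis using that rR s0 n1 by (auto simp: powr_powr)
        qed
        have "\<phi> s = \<omega> * (1 / s) * (1 + n * - (\<rho> * s powr (1 / n)))" using \<phi>(2) s s0 by simp
        also have "\<dots> \<le> \<omega> * (1 / s) * (1 + - (\<rho> * s powr (1 / n))) ^ DIM('a)"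
          unfolding n_def using \<omega>0 s0 \<rho>s
          by (intro mult_left_mono Bernoulli_inequality) (auto simp: n_def)
        also have "\<dots> = \<omega> * r ^ DIM('a)"
        proof -
          have "1 / s = (s powr (- 1 / n)) powr n" unfolding powr_powr using s0 n1 by (simp add: powr_minus_divide)
          also have "\<dots> = (s powr (- 1 / n)) ^ DIM('a)" using s0 by (simp add: n_def powr_realpow)
          finally have "1 / s * (1 + - (\<rho> * s powr (1 / n))) ^ DIM('a)
              = (s powr (- 1 / n) * (1 + - (\<rho> * s powr (1 / n)))) ^ DIM('a)"
            by (simp add: power_mult_distrib)
          also have "s powr (- 1 / n) * (1 + - (\<rho> * s powr (1 / n))) = r"
            using root by (simp add: r_def algebra_simps)
          finally show ?thesis by (metis mult.assoc)
        qed
        finally have "ennreal (\<phi> s) \<le> emeasure lborel (ball x\<^sub>0 r)"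
          using emeasure_ball[OF r0, of x\<^sub>0] content_ball[of 1 "0::'a"] by (simp add: \<omega>_def ennreal_leI)
        also have "\<dots> = (\<integral>\<^sup>+ y. indicator (ball x\<^sub>0 r) y \<partial>lborel)" by simp
        also have "\<dots> \<le> (\<integral>\<^sup>+ y. indicator (ball x\<^sub>0 R) y * indicator {s<..} (g y) \<partial>lborel)"
          using sub by (intro nn_integral_mono) (auto split: split_indicator)
        finally show ?thesis using s by simp
      qed simp
    qed
  qed
  also have "\<dots> = (\<integral>\<^sup>+ y. indicator (ball x\<^sub>0 R) y * ennreal (g y - a) \<partial>lborel)"
    by (intro lborel.layer_cake_weighted[symmetric]) (auto simp: g_def[abs_def] intro!: borel_measurable_indicator)
  also have "\<dots> \<le> (\<integral>\<^sup>+ y\<in>ball x\<^sub>0 R. ennreal ((norm (x\<^sub>0 - y) + \<rho>) powr - n) \<partial>lborel)"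
    using a0 by (intro nn_integral_mono) (auto simp: g_def intro!: ennreal_leI split: split_indicator)
  finally show ?thesis .
qed

text \<open>The kernel exceeds \<open>s\<close> on a punctured ball of radius
  \<open>s powr (- 1 / d)\<close>, of measure at least \<open>C\<^sub>0 / s\<close>, and
  \<open>1 / s\<close> is not integrable at infinity. The upper growth excludes mass at the centre,
  where the kernel is 0 because \<open>0 powr - d = 0\<close>.\<close>

lemma nn_integral_distance_powr_eq_top:
  fixes \<nu> :: "'a::euclidean_space measure" and d C\<^sub>0 \<rho>\<^sub>0 C r :: real
  assumes fin: "finite_measure \<nu>" and sets: "sets \<nu> = sets borel"
    and d: "0 < d" and C\<^sub>0: "0 < C\<^sub>0" and \<rho>\<^sub>0: "0 < \<rho>\<^sub>0" and r: "0 < r" and C: "0 < C"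
    and lower: "\<And>\<rho>. 0 < \<rho> \<Longrightarrow> \<rho> \<le> \<rho>\<^sub>0 \<Longrightarrow> ennreal (C\<^sub>0 * \<rho> powr d) \<le> emeasure \<nu> (ball x\<^sub>0 \<rho>)"
    and upper: "\<And>\<rho>. 0 < \<rho> \<Longrightarrow> emeasure \<nu> (ball x\<^sub>0 \<rho>) \<le> ennreal (C * \<rho> powr d)"
  shows "(\<integral>\<^sup>+ x\<in>ball x\<^sub>0 r. ennreal (norm (x - x\<^sub>0) powr - d) \<partial>\<nu>) = \<infinity>"
proof (rule ennreal_eq_top_if_unbounded)
  fix k :: real assume k: "0 < k"
  interpret finite_measure \<nu> by (rule fin)
  have sp: "space \<nu> = UNIV" using sets by (metis sets_eq_imp_space_eq space_borel)
  have [measurable]: "(\<lambda>x. norm (x - x\<^sub>0)) \<in> borel_measurable \<nu>"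
    using sets by (simp cong: measurable_cong_sets)
  have [measurable]: "ball x\<^sub>0 t \<in> sets \<nu>" "{x\<^sub>0} \<in> sets \<nu>" for t using sets by auto
  have null: "emeasure \<nu> {x\<^sub>0} = 0"
  proof (rule ccontr)
    assume "emeasure \<nu> {x\<^sub>0} \<noteq> 0"
    moreover obtain v where v: "emeasure \<nu> {x\<^sub>0} = ennreal v" "0 \<le> v"
      by (metis emeasure_eq_measure measure_nonneg)
    ultimately have v0: "0 < v" by (cases "v = 0") auto
    \<comment> \<open>The radius at which the upper growth bound is half the supposed mass of the
      centre.\<close>
    define t where "t = (v / (2 * C)) powr (1 / d)"
    have t: "0 < t" "C * t powr d = v / 2" using v0 C d by (auto simp: t_def powr_powr)
    have "ennreal v \<le> emeasure \<nu> (ball x\<^sub>0 t)"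
      unfolding v(1)[symmetric] using t by (intro emeasure_mono) auto
    also have "\<dots> \<le> ennreal (v / 2)" using upper[OF t(1)] t(2) by simp
    finally show False using v0 by (simp add: ennreal_le_iff2)
  qed
  define g where "g x = norm (x - x\<^sub>0) powr - d" for x
  have [measurable]: "g \<in> borel_measurable \<nu>" by (simp add: g_def[abs_def])
  define t\<^sub>0 where "t\<^sub>0 = min r \<rho>\<^sub>0"
  have t\<^sub>0: "0 < t\<^sub>0" using r \<rho>\<^sub>0 by (simp add: t\<^sub>0_def)
  \<comment> \<open>Above \<open>a\<close> the radii stay below \<open>r\<close> and
    \<open>\<rho>\<^sub>0\<close>; \<open>b\<close> is chosen so that \<open>C\<^sub>0 / s\<close>
    integrates to \<open>k\<close> between them.\<close>
  define a where "a = t\<^sub>0 powr - d"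
  define b where "b = a * exp (k / C\<^sub>0)"
  have a0: "0 < a" using t\<^sub>0 by (simp add: a_def)
  have ab: "a \<le> b" using a0 k C\<^sub>0 by (simp add: b_def)
  have "ennreal k = (\<integral>\<^sup>+ s. ennreal (C\<^sub>0 / s) * indicator {a..b} s \<partial>lborel)"
    using nn_integral_inverse_Icc[OF a0 ab, of C\<^sub>0] C\<^sub>0 a0 by (simp add: b_def)
  also have "\<dots> \<le> (\<integral>\<^sup>+ s. (\<integral>\<^sup>+ y. indicator (ball x\<^sub>0 r) y * indicator {s<..} (g y) \<partial>\<nu>) * indicator {a<..} s \<partial>lborel)"
  proof (rule nn_integral_mono_AE)
    have "AE s in lborel. s \<noteq> a" by (rule AE_lborel_singleton)
    then show "AE s in lborel. ennreal (C\<^sub>0 / s) * indicator {a..b} s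
        \<le> (\<integral>\<^sup>+ y. indicator (ball x\<^sub>0 r) y * indicator {s<..} (g y) \<partial>\<nu>) * indicator {a<..} s"
    proof eventually_elim
      case (elim s)
      show ?case
      proof (cases "s \<in> {a..b}")
        case True
        then have s: "a < s" and s0: "0 < s" using elim a0 by auto
        define t where "t = s powr (- 1 / d)"
        have t: "0 < t" "t powr d = 1 / s" "t powr - d = s"
          unfolding t_def powr_powr using s0 d by (auto simp: powr_minus_divide)
        have "t \<le> a powr (- 1 / d)"
          unfolding t_def using s a0 d by (intro powr_mono2') auto
        also have "\<dots> = t\<^sub>0" using t\<^sub>0 d by (simp add: a_def powr_powr)
        finally have tt: "t \<le> r" "t \<le> \<rho>\<^sub>0" by (auto simp: t\<^sub>0_def)
        have sub: "y \<in> ball x\<^sub>0 r \<and> s < g y" if "y \<in> ball x\<^sub>0 t - {x\<^sub>0}" for y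
        proof -
          have "0 < norm (y - x\<^sub>0)" "norm (y - x\<^sub>0) < t" using that by (auto simp: dist_norm norm_minus_commute)
          then have "t powr - d < g y" unfolding g_def using d by (intro powr_less_mono2_neg) auto
          then show ?thesis using that tt t by auto
        qed
        have "ennreal (C\<^sub>0 / s) \<le> emeasure \<nu> (ball x\<^sub>0 t)"
          using lower[OF t(1) tt(2)] t by simp
        also have "\<dots> = emeasure \<nu> (ball x\<^sub>0 t - {x\<^sub>0})"
          using null by (intro emeasure_Diff_null_set[symmetric]) (auto simp: null_sets_def)
        also have "\<dots> = (\<integral>\<^sup>+ y. indicator (ball x\<^sub>0 t - {x\<^sub>0}) y \<partial>\<nu>)" by simp
        also have "\<dots> \<le> (\<integral>\<^sup>+ y. indicator (ball x\<^sub>0 r) y * indicator {s<..} (g y) \<partial>\<nu>)"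
          using sub by (intro nn_integral_mono) (auto split: split_indicator)
        finally show ?thesis using True s by simp
      qed simp
    qed
  qed
  also have "\<dots> = (\<integral>\<^sup>+ y. indicator (ball x\<^sub>0 r) y * ennreal (g y - a) \<partial>\<nu>)"
    by (intro layer_cake_weighted[symmetric]) measurable
  also have "\<dots> \<le> (\<integral>\<^sup>+ x\<in>ball x\<^sub>0 r. ennreal (norm (x - x\<^sub>0) powr - d) \<partial>\<nu>)"
    using a0 by (intro nn_integral_mono) (auto simp: g_def intro!: ennreal_leI split: split_indicator)
  finally show "ennreal k \<le> (\<integral>\<^sup>+ x\<in>ball x\<^sub>0 r. ennreal (norm (x - x\<^sub>0) powr - d) \<partial>\<nu>)" .
qed

text \<open>The base is the volume of the ball about \<open>x\<^sub>0\<close> with \<open>y\<close>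
  on its boundary, so on the whole space the rearrangement is
  \<open>t powr (- \<alpha> / n)\<close>, the extremal one. At \<open>x\<^sub>0\<close> the value is
  0 by the \<open>powr\<close> convention.\<close>

definition critical_density :: "real \<Rightarrow> real^'n \<Rightarrow> real^'n \<Rightarrow> real" where
  "critical_density \<alpha> x\<^sub>0 y =
     (measure lebesgue (ball (0::real^'n) 1) * norm (x\<^sub>0 - y) powr real CARD('n)) powr (- \<alpha> / real CARD('n))"

lemma critical_density_nonneg: "0 \<le> critical_density \<alpha> x\<^sub>0 y"
  by (simp add: critical_density_def)

lemma critical_density_weak_norm:
  fixes \<Omega> :: "(real^'n) set"
  assumes \<Omega>: "\<Omega> \<in> sets lebesgue" and \<alpha>: "0 < \<alpha>"
  shows "weak_norm \<Omega> (real CARD('n) / \<alpha>) (critical_density \<alpha> x\<^sub>0) \<le> 1"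
  unfolding weak_norm_def
proof (rule SUP_least)
  let ?n = "real CARD('n)" and ?\<omega> = "measure lebesgue (ball (0::real^'n) 1)"
  fix s assume "s \<in> {s. 0 < s \<and> ennreal s < emeasure lebesgue \<Omega>}"
  then have s: "0 < s" by simp
  have \<omega>0: "0 < ?\<omega>" by simp
  have n0: "0 < ?n" by simp
  define l where "l = s powr (- \<alpha> / ?n)"
  have l: "0 < l" using s by (simp add: l_def)
  define r where "r = (s / ?\<omega>) powr (1 / ?n)"
  have r: "0 \<le> r" "?\<omega> * r powr ?n = s" using s \<omega>0 n0 by (simp_all add: r_def powr_powr)
  have "norm (x\<^sub>0 - y) < r" if "l < critical_density \<alpha> x\<^sub>0 y" for y
  proof (rule ccontr)
    assume "\<not> norm (x\<^sub>0 - y) < r"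
    then have "?\<omega> * r powr ?n \<le> ?\<omega> * norm (x\<^sub>0 - y) powr ?n"
      using r \<omega>0 by (intro mult_left_mono powr_mono2) auto
    then have "critical_density \<alpha> x\<^sub>0 y \<le> l"
      unfolding critical_density_def l_def r(2) using s \<alpha> by (intro powr_mono2') auto
    then show False using that by simp
  qed
  then have "emeasure lebesgue {x \<in> \<Omega>. l < \<bar>critical_density \<alpha> x\<^sub>0 x\<bar>} \<le> emeasure lebesgue (ball x\<^sub>0 r)"
    by (intro emeasure_mono) (auto simp: critical_density_nonneg dist_norm)
  also have "\<dots> = ennreal s"
  proof -
    have "0 < r" using s \<omega>0 by (simp add: r_def)
    then show ?thesis using emeasure_lebesgue_ball[OF r(1), of x\<^sub>0] r(2) by (simp add: powr_realpow)
  qed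
  finally have "rearrangement \<Omega> (critical_density \<alpha> x\<^sub>0) s \<le> ennreal l"
    unfolding rearrangement_def using l by (intro Inf_lower) auto
  then have "ennreal (s powr (1 / (?n / \<alpha>))) * rearrangement \<Omega> (critical_density \<alpha> x\<^sub>0) s
      \<le> ennreal (s powr (1 / (?n / \<alpha>))) * ennreal l"
    by (rule mult_left_mono) simp
  also have "\<dots> = ennreal (s powr (\<alpha> / ?n) * l)"
    using l by (simp add: ennreal_mult)
  also have "s powr (\<alpha> / ?n) * l = 1"
    using s by (simp add: l_def flip: powr_add)
  finally show "ennreal (s powr (1 / (?n / \<alpha>))) * rearrangement \<Omega> (critical_density \<alpha> x\<^sub>0) s \<le> 1"
    by simp
qed

lemma critical_density_measurable: "critical_density \<alpha> x\<^sub>0 \<in> borel_measurable borel"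
  unfolding critical_density_def[abs_def] by measurable

text \<open>The triangle inequality bounds the integrand below by a multiple of the shifted kernel.
  The coefficient \<open>\<omega> powr (- \<alpha> / n) * \<omega> * n\<close> equals that of the
  upper estimate, so both bounds share the same logarithm and the critical exponent is
  exact.\<close>

lemma riesz_potential_critical_density_ge:
  fixes \<Omega> :: "(real^'n) set" and \<alpha> R :: real
  defines "n \<equiv> real CARD('n)" and "\<omega> \<equiv> measure lebesgue (ball (0::real^'n) 1)"
  assumes \<alpha>: "0 < \<alpha>" "\<alpha> < n" and R: "ball x\<^sub>0 R \<subseteq> \<Omega>"
    and x: "x \<noteq> x\<^sub>0" "n * norm (x - x\<^sub>0) \<le> R"
  shows "ereal (1 / riesz_const TYPE('n) \<alpha> * (n * \<omega> powr (1 - \<alpha> / n)) * (ln (R / (n * norm (x - x\<^sub>0))) - 1))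
    \<le> riesz_potential \<alpha> (zero_extension \<Omega> (critical_density \<alpha> x\<^sub>0)) x"
proof -
  let ?f = "zero_extension \<Omega> (critical_density \<alpha> x\<^sub>0)" and ?rc = "riesz_const TYPE('n) \<alpha>"
  define \<rho> where "\<rho> = norm (x - x\<^sub>0)"
  define T where "T = ln (R / (n * \<rho>)) - 1"
  have \<rho>0: "0 < \<rho>" using x by (simp add: \<rho>_def)
  have n0: "0 < n" using \<alpha> by simp
  have \<omega>0: "0 < \<omega>" by (simp add: \<omega>_def)
  have [measurable]: "ball x\<^sub>0 R \<in> sets borel" by simp
  have rc: "0 < ?rc" using \<alpha> unfolding n_def by (rule riesz_const_pos)
  define P where "P = (\<integral>\<^sup>+ y. ennreal (?f y / norm (x - y) powr (n - \<alpha>)) \<partial>lebesgue)"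
  \<comment> \<open>The density is nonnegative, so the potential reduces to its positive part and no
    difference of infinities occurs.\<close>
  have f0: "0 \<le> ?f y" for y by (simp add: zero_extension_def critical_density_nonneg)
  have "(\<integral>\<^sup>+ y. ennreal (- ?f y / norm (x - y) powr (n - \<alpha>)) \<partial>lebesgue) = (\<integral>\<^sup>+ y. 0 \<partial>(lebesgue :: (real^'n) measure))"
    by (rule nn_integral_cong) (use f0 in \<open>simp add: ennreal_neg\<close>)
  then have riesz: "riesz_potential \<alpha> ?f x = ereal (1 / ?rc) * enn2ereal P"
    unfolding riesz_potential_def n_def P_def by (simp add: zero_ennreal.rep_eq)
  have "ennreal (\<omega> powr (- \<alpha> / n)) * ennreal (\<omega> * n * T)
      \<le> ennreal (\<omega> powr (- \<alpha> / n)) * (\<integral>\<^sup>+ y\<in>ball x\<^sub>0 R. ennreal ((norm (x\<^sub>0 - y) + \<rho>) powr - n) \<partial>lborel)"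
    using nn_integral_shifted_distance_ge[of \<rho> R x\<^sub>0] x(2) \<rho>0
    by (intro mult_left_mono) (simp_all add: n_def \<omega>_def \<rho>_def T_def)
  also have "\<dots> = (\<integral>\<^sup>+ y. ennreal (\<omega> powr (- \<alpha> / n)) * (ennreal ((norm (x\<^sub>0 - y) + \<rho>) powr - n) * indicator (ball x\<^sub>0 R) y) \<partial>lborel)"
    by (rule nn_integral_cmult[symmetric]) measurable
  also have "\<dots> \<le> (\<integral>\<^sup>+ y. ennreal (?f y / norm (x - y) powr (n - \<alpha>)) \<partial>lborel)"
  proof (rule nn_integral_mono_AE)
    \<comment> \<open>The points \<open>x\<close> and \<open>x\<^sub>0\<close> are excluded because
      there the \<open>powr\<close> convention gives 0 in place of the singularity.\<close>
    have "AE y in lborel. y \<noteq> x" "AE y in lborel. y \<noteq> x\<^sub>0" by (rule AE_lborel_singleton)+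
    then show "AE y in lborel. ennreal (\<omega> powr (- \<alpha> / n)) * (ennreal ((norm (x\<^sub>0 - y) + \<rho>) powr - n) * indicator (ball x\<^sub>0 R) y)
        \<le> ennreal (?f y / norm (x - y) powr (n - \<alpha>))"
    proof eventually_elim
      case (elim y)
      show ?case
      proof (cases "y \<in> ball x\<^sub>0 R")
        case True
        let ?t = "norm (x\<^sub>0 - y)"
        have t: "0 < ?t" "0 < norm (x - y)" using elim by auto
        have tri: "norm (x - y) \<le> ?t + \<rho>"
          using norm_triangle_ineq[of "x - x\<^sub>0" "x\<^sub>0 - y"] by (simp add: \<rho>_def)
        \<comment> \<open>replacing both factors by this radial minorant loses only a bounded amount\<close>
        have "(?t + \<rho>) powr - n = (?t + \<rho>) powr - \<alpha> * (?t + \<rho>) powr (\<alpha> - n)"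
          by (simp flip: powr_add)
        also have "\<dots> \<le> ?t powr - \<alpha> * norm (x - y) powr (\<alpha> - n)"
          using t tri \<rho>0 \<alpha> by (intro mult_mono powr_mono2') auto
        finally have "\<omega> powr (- \<alpha> / n) * (?t + \<rho>) powr - n
            \<le> \<omega> powr (- \<alpha> / n) * (?t powr - \<alpha> * norm (x - y) powr (\<alpha> - n))"
          by (rule mult_left_mono) simp
        also have "\<dots> = critical_density \<alpha> x\<^sub>0 y / norm (x - y) powr (n - \<alpha>)"
        proof -
          have "critical_density \<alpha> x\<^sub>0 y = \<omega> powr (- \<alpha> / n) * ?t powr (n * (- \<alpha> / n))"
            unfolding critical_density_def \<omega>_def[symmetric] n_def[symmetric] using \<omega>0
            by (simp add: powr_mult powr_powr)
          then show ?thesis using n0 by (simp add: powr_diff)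
        qed
        also have "\<dots> = ?f y / norm (x - y) powr (n - \<alpha>)"
          using True R by (auto simp: zero_extension_def)
        finally show ?thesis
          using True by (simp add: ennreal_leI flip: ennreal_mult)
      qed simp
    qed
  qed
  also have "\<dots> = P" unfolding P_def by (rule nn_integral_completion[symmetric])
  finally have "ennreal (\<omega> powr (- \<alpha> / n) * (\<omega> * n * T)) \<le> P"
    by (simp add: ennreal_mult')
  then have "enn2ereal (ennreal (\<omega> powr (- \<alpha> / n) * (\<omega> * n * T))) \<le> enn2ereal P"
    by (simp add: less_eq_ennreal.rep_eq)
  \<comment> \<open>\<open>v\<close> may be negative, where \<open>ennreal\<close> truncates to 0;
    the inequality survives.\<close>
  moreover have "ereal v \<le> enn2ereal (ennreal v)" for v
    by (cases "0 \<le> v") (auto simp: ennreal_neg zero_ennreal.rep_eq)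
  ultimately have "ereal (\<omega> powr (- \<alpha> / n) * (\<omega> * n * T)) \<le> enn2ereal P"
    by (rule order_trans[rotated])
  then have "ereal (1 / ?rc) * ereal (\<omega> powr (- \<alpha> / n) * (\<omega> * n * T)) \<le> riesz_potential \<alpha> ?f x"
    unfolding riesz using rc by (intro ereal_mult_left_mono) auto
  moreover have "\<omega> powr (- \<alpha> / n) * (\<omega> * n * T) = n * \<omega> powr (1 - \<alpha> / n) * T"
    using \<omega>0 by (simp add: powr_diff powr_minus_divide)
  ultimately have "ereal (1 / ?rc) * ereal (n * \<omega> powr (1 - \<alpha> / n) * T) \<le> riesz_potential \<alpha> ?f x"
    by (simp only:)
  then show ?thesis by (simp add: T_def \<rho>_def mult.assoc)
qed

section \<open>Divergence at and above the critical exponent\<close>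

lemma supercritical_exp_integral_eq_top:
  fixes \<Omega> :: "(real^'n) set" and \<alpha> d :: real
  assumes \<Omega>: "open \<Omega>" "bounded \<Omega>" and \<alpha>: "0 < \<alpha>" "\<alpha> < real CARD('n)" and d: "0 < d"
    and C: "0 < C" and \<gamma>: "critical_const TYPE('n) \<alpha> d \<le> \<gamma>"
    and \<nu>: "borel_measure_on \<Omega> \<nu>" "upper_growth \<nu> d C"
    and lower: "x\<^sub>0 \<in> \<Omega>" "0 < \<rho>\<^sub>0" "0 < C\<^sub>0"
      "\<And>\<rho>. 0 < \<rho> \<Longrightarrow> \<rho> \<le> \<rho>\<^sub>0 \<Longrightarrow> ennreal (C\<^sub>0 * \<rho> powr d) \<le> emeasure \<nu> (ball x\<^sub>0 \<rho> \<inter> \<Omega>)"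
  shows "exp_integral \<Omega> \<nu> \<alpha> \<gamma> (critical_density \<alpha> x\<^sub>0) = \<infinity>"
proof -
  define n where "n = real CARD('n)"
  define \<omega> where "\<omega> = measure lebesgue (ball (0::real^'n) 1)"
  define rc where "rc = riesz_const TYPE('n) \<alpha>"
  define L where "L = n * \<omega> powr (1 - \<alpha> / n)"
  have n1: "1 \<le> n" by (simp add: n_def Suc_leI)
  have \<omega>0: "0 < \<omega>" by (simp add: \<omega>_def)
  have L0: "0 < L" using n1 \<omega>0 by (simp add: L_def)
  have rc0: "0 < rc" unfolding rc_def by (rule riesz_const_pos[OF \<alpha>])
  have \<gamma>1: "d / L * rc \<le> \<gamma>"
    using \<gamma> critical_const_eq[OF \<alpha>, of d] by (simp add: L_def n_def \<omega>_def rc_def)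
  have crit0: "0 \<le> d / L * rc" using d L0 rc0 by simp
  obtain R where R: "0 < R" "ball x\<^sub>0 R \<subseteq> \<Omega>"
    using \<Omega>(1) lower(1) by (meson open_contains_ball)
  have sets\<nu>: "sets \<nu> = sets borel" using \<nu> by (simp add: borel_measure_on_def)
  have ball: "emeasure \<nu> (ball x r) \<le> ennreal (C * r powr d)" if "0 < r" for x r
    using \<nu>(2) that by (auto simp: upper_growth_def)
  have fin: "finite_measure \<nu>"
  proof (rule finite_measureI)
    obtain a where a: "\<Omega> \<subseteq> ball 0 a" using \<Omega>(2) bounded_subset_ballD by blast
    have "space \<nu> = UNIV" using sets\<nu> by (metis sets_eq_imp_space_eq space_borel)
    then have "emeasure \<nu> (space \<nu>) = emeasure \<nu> (ball 0 (max a 1) \<union> - \<Omega>)"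
      using a by (intro arg_cong[where f="emeasure \<nu>"]) auto
    also have "\<dots> \<le> emeasure \<nu> (ball 0 (max a 1)) + emeasure \<nu> (- \<Omega>)"
      using \<Omega> sets\<nu> by (intro emeasure_subadditive) auto
    also have "\<dots> \<le> ennreal (C * max a 1 powr d)"
      using \<nu>(1) ball[of "max a 1" 0] by (simp add: borel_measure_on_def)
    finally show "emeasure \<nu> (space \<nu>) \<noteq> \<infinity>" by (auto simp: top_unique)
  qed
  let ?P = "\<lambda>x. riesz_potential \<alpha> (zero_extension \<Omega> (critical_density \<alpha> x\<^sub>0)) x"
  \<comment> \<open>The constant left when \<open>exp (d * (ln (R / (n * \<rho>)) - 1))\<close> is
    written as \<open>E * \<rho> powr - d\<close>.\<close>
  define E where "E = exp (d * (ln (R / n) - 1))"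
  have E0: "0 < E" by (simp add: E_def)
  have Rn: "0 < R / n" using R n1 by simp
  have [measurable]: "(\<lambda>x. norm (x - x\<^sub>0)) \<in> borel_measurable \<nu>" "ball x\<^sub>0 (R / n) \<in> sets \<nu>"
    using sets\<nu> by (auto cong: measurable_cong_sets)
  have top: "(\<integral>\<^sup>+ x\<in>ball x\<^sub>0 (R / n). ennreal (norm (x - x\<^sub>0) powr - d) \<partial>\<nu>) = \<infinity>"
  proof (rule nn_integral_distance_powr_eq_top[OF fin sets\<nu> d lower(3,2) Rn C _ ball])
    fix \<rho> :: real assume "0 < \<rho>" "\<rho> \<le> \<rho>\<^sub>0"
    then have "ennreal (C\<^sub>0 * \<rho> powr d) \<le> emeasure \<nu> (ball x\<^sub>0 \<rho> \<inter> \<Omega>)" by (rule lower(4))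
    also have "\<dots> \<le> emeasure \<nu> (ball x\<^sub>0 \<rho>)" using sets\<nu> by (intro emeasure_mono) auto
    finally show "ennreal (C\<^sub>0 * \<rho> powr d) \<le> emeasure \<nu> (ball x\<^sub>0 \<rho>)" .
  qed
  have "\<infinity> = ennreal E * (\<integral>\<^sup>+ x\<in>ball x\<^sub>0 (R / n). ennreal (norm (x - x\<^sub>0) powr - d) \<partial>\<nu>)"
    unfolding top using E0 by (simp add: ennreal_mult_top)
  also have "\<dots> = (\<integral>\<^sup>+ x. ennreal E * (ennreal (norm (x - x\<^sub>0) powr - d) * indicator (ball x\<^sub>0 (R / n)) x) \<partial>\<nu>)"
    by (rule nn_integral_cmult[symmetric]) measurable
  also have "\<dots> \<le> exp_integral \<Omega> \<nu> \<alpha> \<gamma> (critical_density \<alpha> x\<^sub>0)"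
    unfolding exp_integral_def
  proof (rule nn_integral_mono)
    fix x
    show "ennreal E * (ennreal (norm (x - x\<^sub>0) powr - d) * indicator (ball x\<^sub>0 (R / n)) x)
        \<le> exp_ereal (ereal \<gamma> * \<bar>?P x\<bar>) * indicator \<Omega> x"
    proof (cases "x \<in> ball x\<^sub>0 (R / n) \<and> x \<noteq> x\<^sub>0")
      case True
      define \<rho> where "\<rho> = norm (x - x\<^sub>0)"
      have \<rho>: "0 < \<rho>" "\<rho> < R / n" using True by (auto simp: \<rho>_def dist_norm norm_minus_commute)
      have n\<rho>: "n * \<rho> \<le> R" using \<rho> n1 by (simp add: field_simps)
      have "\<rho> \<le> n * \<rho>" using n1 \<rho> by simp
      then have "\<rho> \<le> R" using n\<rho> by linarith
      have "R / n \<le> R" using n1 R by (simp add: divide_le_eq mult_le_cancel_left1)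
      then have x\<Omega>: "x \<in> \<Omega>" using True R by auto
      have "ereal (1 / rc * L * (ln (R / (n * \<rho>)) - 1)) \<le> ?P x"
        unfolding rc_def L_def n_def \<omega>_def \<rho>_def
        using True n\<rho> \<alpha> R by (intro riesz_potential_critical_density_ge) (auto simp: n_def \<rho>_def)
      also have "\<dots> \<le> \<bar>?P x\<bar>" by (cases "?P x") auto
      finally have P: "ereal (1 / rc * L * (ln (R / (n * \<rho>)) - 1)) \<le> \<bar>?P x\<bar>" .
      \<comment> \<open>At the critical exponent the constants of the potential cancel and exactly
        \<open>d\<close> remains in front of the logarithm.\<close>
      have "ereal (d * (ln (R / n) - 1) - d * ln \<rho>) = ereal (d / L * rc) * ereal (1 / rc * L * (ln (R / (n * \<rho>)) - 1))"
        using L0 rc0 \<rho> n1 R by (simp add: ln_div ln_mult algebra_simps)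
      also have "\<dots> \<le> ereal (d / L * rc) * \<bar>?P x\<bar>"
        using P crit0 by (intro ereal_mult_left_mono) auto
      also have "\<dots> \<le> ereal \<gamma> * \<bar>?P x\<bar>"
        using \<gamma>1 by (intro ereal_mult_right_mono) auto
      finally have "exp_ereal (ereal (d * (ln (R / n) - 1) - d * ln \<rho>)) \<le> exp_ereal (ereal \<gamma> * \<bar>?P x\<bar>)"
        by (rule exp_ereal_mono)
      moreover have "exp (d * (ln (R / n) - 1) - d * ln \<rho>) = E * \<rho> powr - d"
        using \<rho> by (simp add: E_def powr_def exp_diff exp_minus divide_inverse)
      ultimately show ?thesis
        using True x\<Omega> E0 by (simp add: exp_ereal_def \<rho>_def ennreal_mult)
    qed auto
  qed
  finally show ?thesis by (simp add: top_unique)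
qed

theorem theorem1p4:
  fixes \<Omega> :: "(real^'n) set" and \<alpha> d :: real
  assumes "CARD('n) \<ge> 2"
    and "open \<Omega>" and "bounded \<Omega>"
    and "0 < \<alpha>" and "\<alpha> < real CARD('n)"
    and "0 < d" and "d \<le> real CARD('n)"
  shows "(\<forall>C\<^sub>d>0. \<forall>\<gamma> < critical_const TYPE('n) \<alpha> d. \<exists>C::real. C > 0 \<and>
            (\<forall>\<nu>. borel_measure_on \<Omega> \<nu> \<and> upper_growth \<nu> d C\<^sub>d \<and> lower_growth \<Omega> \<nu> d \<longrightarrow>
               (\<forall>f \<in> weak_Lp \<Omega> (real CARD('n) / \<alpha>).
                  weak_norm \<Omega> (real CARD('n) / \<alpha>) (\<lambda>x. \<bar>f x\<bar>) \<le> 1 \<longrightarrow>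
                  exp_integral \<Omega> \<nu> \<alpha> \<gamma> f \<le> ennreal C)))
       \<and> (\<forall>C\<^sub>d>0. \<forall>\<nu>. borel_measure_on \<Omega> \<nu> \<and> upper_growth \<nu> d C\<^sub>d \<and> lower_growth \<Omega> \<nu> d \<longrightarrow>
            (\<forall>\<gamma> \<ge> critical_const TYPE('n) \<alpha> d.
               \<not> (\<exists>C::real. \<forall>f \<in> weak_Lp \<Omega> (real CARD('n) / \<alpha>).
                  weak_norm \<Omega> (real CARD('n) / \<alpha>) (\<lambda>x. \<bar>f x\<bar>) \<le> 1 \<longrightarrow>
                  exp_integral \<Omega> \<nu> \<alpha> \<gamma> f \<le> ennreal C)))"
proof (rule conjI; intro allI impI)
  fix C\<^sub>d \<gamma> :: real assume "0 < C\<^sub>d" "\<gamma> < critical_const TYPE('n) \<alpha> d"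
  from subcritical_exp_integral_bounded[OF assms(2-6) this]
  show "\<exists>C::real. C > 0 \<and>
      (\<forall>\<nu>. borel_measure_on \<Omega> \<nu> \<and> upper_growth \<nu> d C\<^sub>d \<and> lower_growth \<Omega> \<nu> d \<longrightarrow>
         (\<forall>f \<in> weak_Lp \<Omega> (real CARD('n) / \<alpha>).
            weak_norm \<Omega> (real CARD('n) / \<alpha>) (\<lambda>x. \<bar>f x\<bar>) \<le> 1 \<longrightarrow>
            exp_integral \<Omega> \<nu> \<alpha> \<gamma> f \<le> ennreal C))"
    by blast
next
  fix C\<^sub>d \<gamma> :: real and \<nu> :: "(real^'n) measure"
  assume C\<^sub>d: "0 < C\<^sub>d" and \<gamma>: "critical_const TYPE('n) \<alpha> d \<le> \<gamma>"
    and \<nu>: "borel_measure_on \<Omega> \<nu> \<and> upper_growth \<nu> d C\<^sub>d \<and> lower_growth \<Omega> \<nu> d"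
  then obtain x\<^sub>0 \<rho>\<^sub>0 C\<^sub>0 where lower: "x\<^sub>0 \<in> \<Omega>" "0 < \<rho>\<^sub>0" "0 < C\<^sub>0"
      "\<And>\<rho>. 0 < \<rho> \<Longrightarrow> \<rho> \<le> \<rho>\<^sub>0 \<Longrightarrow> ennreal (C\<^sub>0 * \<rho> powr d) \<le> emeasure \<nu> (ball x\<^sub>0 \<rho> \<inter> \<Omega>)"
    unfolding lower_growth_def by blast
  \<comment> \<open>A single function of norm at most 1, centred at the point of lower growth and
    independent of \<open>\<gamma>\<close>, already has an infinite integral.\<close>
  let ?f = "critical_density \<alpha> x\<^sub>0 :: real^'n \<Rightarrow> real"
  have \<Omega>: "\<Omega> \<in> sets lebesgue" using assms(2) by (simp add: borel_open)
  have norm: "weak_norm \<Omega> (real CARD('n) / \<alpha>) ?f \<le> 1"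
    using \<Omega> assms(4) by (rule critical_density_weak_norm)
  have "?f \<in> borel_measurable (lebesgue_on \<Omega>)"
    using critical_density_measurable by (intro measurable_restrict_space1 measurable_completion) simp
  then have "?f \<in> weak_Lp \<Omega> (real CARD('n) / \<alpha>)"
    using norm by (auto simp: weak_Lp_def top_unique less_top[symmetric])
  moreover have "weak_norm \<Omega> (real CARD('n) / \<alpha>) (\<lambda>x. \<bar>?f x\<bar>) \<le> 1"
    using norm by (simp add: critical_density_nonneg)
  moreover have "exp_integral \<Omega> \<nu> \<alpha> \<gamma> ?f = \<infinity>"
    using supercritical_exp_integral_eq_top[OF assms(2-6) C\<^sub>d \<gamma> _ _ lower] \<nu> by blast
  ultimately show "\<not> (\<exists>C::real. \<forall>f \<in> weak_Lp \<Omega> (real CARD('n) / \<alpha>).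
      weak_norm \<Omega> (real CARD('n) / \<alpha>) (\<lambda>x. \<bar>f x\<bar>) \<le> 1 \<longrightarrow>
      exp_integral \<Omega> \<nu> \<alpha> \<gamma> f \<le> ennreal C)"
    by (metis ennreal_neq_top infinity_ennreal_def top_unique)
qed

end
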